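(* Let $d\geq 4$ and let $O$ be an equipment of the symmetric group $\Sigma_d$. Then $a_{(\Sigma_d,O)}=2$ if and only if $O$ consists of conjugacy classes of odd permutations such that they can be written as a product of disjoint cycles with no two cycles of the same length (including length $1$) and conjugacy classes of even permutations such that they can be written as a product of disjoint cycles with no cycles of even length. Otherwise, $a_{(\Sigma_d,O)}=1$.
   Context: An equipment of a finite group $G$ is a subset $O\subset G$ that is a union of conjugacy classes of $G$ and generates $G$ (so an equipment of $\Sigma_d$ necessarily contains a class of odd permutations). Ambiguity index: let $\widetilde G$ be the group generated by the letters $y_g$, $g\in O$, subject to the relations $y_{g_1}y_{g_2}=y_{g_2}y_{g_2^{-1}g_1g_2}=y_{g_1g_2g_1^{-1}}y_{g_1}$ for all $g_1,g_2\in O$, and let $\beta:\widetilde G\to G$ be the homomorphism with $\beta(y_g)=g$. The commutator subgroup $[\widetilde G,\widetilde G]$ is known to be finite, and $a_{(G,O)}$ is the order of $\ker\beta\cap[\widetilde G,\widetilde G]$. "Including length $1$" means that fixed points are counted as cycles of length $1$, so at most one fixed point is allowed in that case. *)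

theory Defs
  imports "HOL-Algebra.Sym_Groups"
begin

section \<open>Groups given by generators and relations\<close>

text \<open>
  A word is a list of signed letters: \<open>(True, s)\<close> stands for the generator \<open>s\<close> and
  \<open>(False, s)\<close> for its formal inverse.  A relator pair \<open>(l, r)\<close> stands for the relation \<open>l = r\<close>.
\<close>

type_synonym 'a word = "(bool \<times> 'a) list"

definition words :: "'a set \<Rightarrow> 'a word set" where
  "words S = lists (UNIV \<times> S)"

inductive pres_eq :: "'a set \<Rightarrow> ('a word \<times> 'a word) set \<Rightarrow> 'a word \<Rightarrow> 'a word \<Rightarrow> bool"
  for S :: "'a set" and R :: "('a word \<times> 'a word) set" where
  refl: "w \<in> words S \<Longrightarrow> pres_eq S R w w"
| sym: "pres_eq S R v w \<Longrightarrow> pres_eq S R w v"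
| trans: "pres_eq S R u v \<Longrightarrow> pres_eq S R v w \<Longrightarrow> pres_eq S R u w"
| cancel: "u \<in> words S \<Longrightarrow> v \<in> words S \<Longrightarrow> s \<in> S \<Longrightarrow>
    pres_eq S R (u @ [(b, s), (\<not> b, s)] @ v) (u @ v)"
| relation: "u \<in> words S \<Longrightarrow> v \<in> words S \<Longrightarrow> (l, r) \<in> R \<Longrightarrow> l \<in> words S \<Longrightarrow> r \<in> words S \<Longrightarrow>
    pres_eq S R (u @ l @ v) (u @ r @ v)"

definition word_class :: "'a set \<Rightarrow> ('a word \<times> 'a word) set \<Rightarrow> 'a word \<Rightarrow> 'a word set" where
  "word_class S R w = {v. pres_eq S R w v}"

definition presented_group :: "'a set \<Rightarrow> ('a word \<times> 'a word) set \<Rightarrow> 'a word set monoid" where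
  "presented_group S R =
    \<lparr> carrier = word_class S R ` words S,
      mult = (\<lambda>A B. \<Union>a\<in>A. \<Union>b\<in>B. word_class S R (a @ b)),
      one = word_class S R [] \<rparr>"

lemma pres_eq_words: "pres_eq S R v w \<Longrightarrow> v \<in> words S \<and> w \<in> words S"
  by (induction rule: pres_eq.induct) (auto simp: words_def)

lemma word_class_eq:
  assumes "pres_eq S R v w"
  shows "word_class S R v = word_class S R w"
  using assms unfolding word_class_def by (blast intro: pres_eq.sym pres_eq.trans)

lemma self_in_word_class: "w \<in> words S \<Longrightarrow> w \<in> word_class S R w"
  by (simp add: word_class_def pres_eq.refl)

lemma pres_eq_append_right:
  assumes "pres_eq S R v w" "x \<in> words S"
  shows "pres_eq S R (v @ x) (w @ x)"
  using assms
proof (induction rule: pres_eq.induct)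
  case (refl w)
  then show ?case by (auto simp: words_def intro: pres_eq.refl)
next
  case (sym v w)
  then show ?case by (blast intro: pres_eq.sym)
next
  case (trans u v w)
  then show ?case by (blast intro: pres_eq.trans)
next
  case (cancel u v s b)
  then show ?case
    using pres_eq.cancel[of u S "v @ x" s R b] by (auto simp: words_def)
next
  case (relation u v l r)
  then show ?case
    using pres_eq.relation[of u S "v @ x" l r R] by (auto simp: words_def)
qed

lemma pres_eq_append_left:
  assumes "pres_eq S R v w" "x \<in> words S"
  shows "pres_eq S R (x @ v) (x @ w)"
  using assms
proof (induction rule: pres_eq.induct)
  case (refl w)
  then show ?case by (auto simp: words_def intro: pres_eq.refl)
next
  case (sym v w)
  then show ?case by (blast intro: pres_eq.sym)
next
  case (trans u v w)
  then show ?case by (blast intro: pres_eq.trans)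
next
  case (cancel u v s b)
  then show ?case
    using pres_eq.cancel[of "x @ u" S v s R b] by (auto simp: words_def)
next
  case (relation u v l r)
  then show ?case
    using pres_eq.relation[of "x @ u" S v l r R] by (auto simp: words_def)
qed

lemma presented_group_mult:
  assumes "v \<in> words S" "w \<in> words S"
  shows "word_class S R v \<otimes>\<^bsub>presented_group S R\<^esub> word_class S R w = word_class S R (v @ w)"
proof -
  have eq: "word_class S R (a @ b) = word_class S R (v @ w)"
    if "a \<in> word_class S R v" "b \<in> word_class S R w" for a b
  proof -
    from that have a: "pres_eq S R v a" and b: "pres_eq S R w b"
      by (simp_all add: word_class_def)
    have "pres_eq S R (v @ w) (a @ w)"
      using a assms(2) by (rule pres_eq_append_right)
    moreover have "pres_eq S R (a @ w) (a @ b)"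
      using b pres_eq_words[OF a] by (blast intro: pres_eq_append_left)
    ultimately show ?thesis
      by (metis word_class_eq)
  qed
  show ?thesis
    unfolding presented_group_def monoid.simps
  proof (intro equalityI subsetI)
    fix x
    assume "x \<in> (\<Union>a\<in>word_class S R v. \<Union>b\<in>word_class S R w. word_class S R (a @ b))"
    then show "x \<in> word_class S R (v @ w)" using eq by blast
  next
    fix x
    assume "x \<in> word_class S R (v @ w)"
    then show "x \<in> (\<Union>a\<in>word_class S R v. \<Union>b\<in>word_class S R w. word_class S R (a @ b))"
      using self_in_word_class assms by blast
  qed
qed

lemma presented_group_inverse:
  assumes "w \<in> words S"
  shows "\<exists>v\<in>words S. pres_eq S R (v @ w) []"
  using assms
proof (induction w)
  case Nil
  then show ?case by (auto simp: words_def intro!: bexI[of _ "[]"] pres_eq.refl)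
next
  case (Cons c w)
  obtain b s where c: "c = (b, s)" by (cases c)
  from Cons.prems have s: "s \<in> S" and w: "w \<in> words S"
    by (auto simp: words_def c)
  from Cons.IH[OF w] obtain v where v: "v \<in> words S" "pres_eq S R (v @ w) []"
    by blast
  have "pres_eq S R ((v @ [(\<not> b, s)]) @ c # w) (v @ w)"
    using pres_eq.cancel[OF v(1) w s, of R "\<not> b"] by (simp add: c)
  then have "pres_eq S R ((v @ [(\<not> b, s)]) @ c # w) []"
    using v(2) by (rule pres_eq.trans)
  moreover have "v @ [(\<not> b, s)] \<in> words S"
    using v(1) s by (auto simp: words_def)
  ultimately show ?case by blast
qed

lemma group_presented_group: "group (presented_group S R)"
proof (rule groupI)
  have car: "carrier (presented_group S R) = word_class S R ` words S"
    and one: "\<one>\<^bsub>presented_group S R\<^esub> = word_class S R []"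
    by (simp_all add: presented_group_def)
  have nil: "[] \<in> words S" by (simp add: words_def)
  have app: "v @ w \<in> words S" if "v \<in> words S" "w \<in> words S" for v w
    using that by (simp add: words_def)
  show "\<one>\<^bsub>presented_group S R\<^esub> \<in> carrier (presented_group S R)"
    using nil by (simp add: car one)
  fix x assume "x \<in> carrier (presented_group S R)"
  then obtain u where u: "u \<in> words S" "x = word_class S R u" by (auto simp: car)
  show "\<one>\<^bsub>presented_group S R\<^esub> \<otimes>\<^bsub>presented_group S R\<^esub> x = x"
    using u nil by (simp add: one presented_group_mult)
  obtain t where t: "t \<in> words S" "pres_eq S R (t @ u) []"
    using presented_group_inverse[OF u(1)] by blast
  then show "\<exists>y\<in>carrier (presented_group S R).
      y \<otimes>\<^bsub>presented_group S R\<^esub> x = \<one>\<^bsub>presented_group S R\<^esub>"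
    using u t(1) by (intro bexI[of _ "word_class S R t"])
      (simp_all add: car one presented_group_mult word_class_eq[OF t(2)])
  fix y assume "y \<in> carrier (presented_group S R)"
  then obtain v where v: "v \<in> words S" "y = word_class S R v" by (auto simp: car)
  show "x \<otimes>\<^bsub>presented_group S R\<^esub> y \<in> carrier (presented_group S R)"
    using u v app by (simp add: car presented_group_mult)
  fix z assume "z \<in> carrier (presented_group S R)"
  then obtain w where w: "w \<in> words S" "z = word_class S R w" by (auto simp: car)
  show "x \<otimes>\<^bsub>presented_group S R\<^esub> y \<otimes>\<^bsub>presented_group S R\<^esub> z =
      x \<otimes>\<^bsub>presented_group S R\<^esub> (y \<otimes>\<^bsub>presented_group S R\<^esub> z)"
    using u v w app by (simp add: presented_group_mult)
qed


section \<open>Equipments and the ambiguity index\<close>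

definition conjugacy_class :: "('a, 'b) monoid_scheme \<Rightarrow> 'a \<Rightarrow> 'a set" where
  "conjugacy_class G x = {g \<otimes>\<^bsub>G\<^esub> x \<otimes>\<^bsub>G\<^esub> inv\<^bsub>G\<^esub> g | g. g \<in> carrier G}"

definition equipment :: "('a, 'b) monoid_scheme \<Rightarrow> 'a set \<Rightarrow> bool" where
  "equipment G E \<longleftrightarrow>
    (\<exists>X \<subseteq> carrier G. E = (\<Union>x\<in>X. conjugacy_class G x)) \<and> generate G E = carrier G"

abbreviation letter :: "'a \<Rightarrow> bool \<times> 'a" where
  "letter g \<equiv> (True, g)"

definition equipment_relations :: "('a, 'b) monoid_scheme \<Rightarrow> 'a set \<Rightarrow> ('a word \<times> 'a word) set" where
  "equipment_relations G E =
    {([letter g, letter h], [letter h, letter (inv\<^bsub>G\<^esub> h \<otimes>\<^bsub>G\<^esub> g \<otimes>\<^bsub>G\<^esub> h)]) | g h. g \<in> E \<and> h \<in> E} \<union>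
    {([letter g, letter h], [letter (g \<otimes>\<^bsub>G\<^esub> h \<otimes>\<^bsub>G\<^esub> inv\<^bsub>G\<^esub> g), letter g]) | g h. g \<in> E \<and> h \<in> E}"

definition equipment_group :: "('a, 'b) monoid_scheme \<Rightarrow> 'a set \<Rightarrow> 'a word set monoid" where
  "equipment_group G E = presented_group E (equipment_relations G E)"

fun word_value :: "('a, 'b) monoid_scheme \<Rightarrow> 'a word \<Rightarrow> 'a" where
  "word_value G [] = \<one>\<^bsub>G\<^esub>"
| "word_value G ((b, g) # w) = (if b then g else inv\<^bsub>G\<^esub> g) \<otimes>\<^bsub>G\<^esub> word_value G w"

text \<open>
  All words in one class have the same value in \<open>G\<close>, see \<open>equipment_hom_word_class\<close> below.
\<close>

definition equipment_hom :: "('a, 'b) monoid_scheme \<Rightarrow> 'a word set \<Rightarrow> 'a" where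
  "equipment_hom G W = the_elem (word_value G ` W)"

definition ambiguity_index :: "('a, 'b) monoid_scheme \<Rightarrow> 'a set \<Rightarrow> nat" where
  "ambiguity_index G E =
    card (kernel (equipment_group G E) G (equipment_hom G) \<inter>
          derived (equipment_group G E) (carrier (equipment_group G E)))"

context group
begin

lemma word_value_closed: "w \<in> words (carrier G) \<Longrightarrow> word_value G w \<in> carrier G"
  by (induction w) (auto simp: words_def)

lemma word_value_append:
  assumes "v \<in> words (carrier G)" "w \<in> words (carrier G)"
  shows "word_value G (v @ w) = word_value G v \<otimes> word_value G w"
  using assms(1)
proof (induction v)
  case Nil
  then show ?case using word_value_closed[OF assms(2)] by simp
next
  case (Cons c v)
  then obtain b g where c: "c = (b, g)" "g \<in> carrier G" and v: "v \<in> words (carrier G)"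
    by (cases c) (simp add: words_def)
  have "(if b then g else inv g) \<in> carrier G" using c by simp
  then show ?case
    using c Cons.IH[OF v] word_value_closed[OF assms(2)] word_value_closed[OF v]
    by (simp only: append_Cons word_value.simps m_assoc)
qed

lemma words_mono: "E \<subseteq> carrier G \<Longrightarrow> w \<in> words E \<Longrightarrow> w \<in> words (carrier G)"
  unfolding words_def by auto

lemma word_value_pres_eq:
  assumes "pres_eq E (equipment_relations G E) v w" "E \<subseteq> carrier G"
  shows "word_value G v = word_value G w"
  using assms
proof (induction rule: pres_eq.induct)
  case (cancel u v s b)
  have s: "s \<in> carrier G" using cancel by blast
  have uv: "u \<in> words (carrier G)" "v \<in> words (carrier G)" using cancel words_mono by blast+
  have c: "[(b, s), (\<not> b, s)] \<in> words (carrier G)" using s by (simp add: words_def)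
  have "word_value G [(b, s), (\<not> b, s)] = \<one>" using s by (cases b) auto
  moreover have "word_value G (u @ [(b, s), (\<not> b, s)] @ v)
      = word_value G u \<otimes> (word_value G [(b, s), (\<not> b, s)] \<otimes> word_value G v)"
    using uv c by (subst word_value_append, force, force simp: words_def,
        subst word_value_append) (auto simp: words_def)
  ultimately show ?case
    using uv word_value_append[OF uv] word_value_closed by simp
next
  case (relation u v l r)
  have w: "u \<in> words (carrier G)" "v \<in> words (carrier G)"
      "l \<in> words (carrier G)" "r \<in> words (carrier G)"
    using relation words_mono by blast+
  have app: "x @ y \<in> words (carrier G)"
    if "x \<in> words (carrier G)" "y \<in> words (carrier G)" for x y
    using that by (simp add: words_def)
  have conj1: "h \<otimes> (inv h \<otimes> g \<otimes> h) = g \<otimes> h" if "g \<in> carrier G" "h \<in> carrier G" for g h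
    using that by (simp only: m_assoc[symmetric] inv_closed m_closed r_inv l_one)
  have conj2: "g \<otimes> h \<otimes> inv g \<otimes> g = g \<otimes> h" if "g \<in> carrier G" "h \<in> carrier G" for g h
    using that by (simp only: m_assoc inv_closed m_closed l_inv r_one)
  from relation(3) have "word_value G l = word_value G r"
    using relation(6) unfolding equipment_relations_def
    by (auto simp: conj1 conj2 subset_iff)
  then show ?case
    using w app by (simp add: word_value_append)
qed auto

lemma equipment_hom_word_class:
  assumes "E \<subseteq> carrier G" "w \<in> words E"
  shows "equipment_hom G (word_class E (equipment_relations G E) w) = word_value G w"
proof -
  have "word_value G ` word_class E (equipment_relations G E) w = {word_value G w}"
    using word_value_pres_eq[OF _ assms(1)] self_in_word_class[OF assms(2)]
    unfolding word_class_def by fastforce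
  then show ?thesis by (simp add: equipment_hom_def)
qed

lemma equipment_hom_letter:
  assumes "E \<subseteq> carrier G" "g \<in> E"
  shows "equipment_hom G (word_class E (equipment_relations G E) [letter g]) = g"
  using equipment_hom_word_class[OF assms(1), of "[letter g]"] assms by (auto simp: words_def)

lemma equipment_hom_hom:
  assumes "E \<subseteq> carrier G"
  shows "equipment_hom G \<in> hom (equipment_group G E) G"
proof (rule homI)
  have car: "carrier (equipment_group G E) = word_class E (equipment_relations G E) ` words E"
    by (simp add: equipment_group_def presented_group_def)
  fix x assume "x \<in> carrier (equipment_group G E)"
  then obtain u where u: "u \<in> words E" "x = word_class E (equipment_relations G E) u"
    by (auto simp: car)
  show "equipment_hom G x \<in> carrier G"
    using u assms words_mono word_value_closed by (simp add: equipment_hom_word_class)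
  fix y assume "y \<in> carrier (equipment_group G E)"
  then obtain v where v: "v \<in> words E" "y = word_class E (equipment_relations G E) v"
    by (auto simp: car)
  have "u @ v \<in> words E" using u v by (simp add: words_def)
  then show "equipment_hom G (x \<otimes>\<^bsub>equipment_group G E\<^esub> y) =
      equipment_hom G x \<otimes> equipment_hom G y"
    using u v assms words_mono[OF assms]
    by (simp add: equipment_group_def presented_group_mult equipment_hom_word_class
        word_value_append)
qed

end


section \<open>Disjoint cycle decompositions\<close>

text \<open>
  \<open>cs\<close> writes the permutation \<open>p\<close> of \<open>{1..d}\<close> as a product of disjoint cycles.  The cycles cover
  \<open>{1..d}\<close>, so each fixed point occurs as a cycle of length \<open>1\<close>.
\<close>

definition disjoint_cycles :: "nat \<Rightarrow> (nat \<Rightarrow> nat) \<Rightarrow> nat list list \<Rightarrow> bool" where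
  "disjoint_cycles d p cs \<longleftrightarrow>
    [] \<notin> set cs \<and> distinct (concat cs) \<and> set (concat cs) = {1..d} \<and>
    p = foldr (\<lambda>c q. cycle_of_list c \<circ> q) cs id"

definition distinct_cycle_lengths :: "nat \<Rightarrow> (nat \<Rightarrow> nat) \<Rightarrow> bool" where
  "distinct_cycle_lengths d p \<longleftrightarrow> (\<exists>cs. disjoint_cycles d p cs \<and> distinct (map length cs))"

definition no_even_cycle_lengths :: "nat \<Rightarrow> (nat \<Rightarrow> nat) \<Rightarrow> bool" where
  "no_even_cycle_lengths d p \<longleftrightarrow> (\<exists>cs. disjoint_cycles d p cs \<and> (\<forall>c\<in>set cs. odd (length c)))"

text \<open>
  The condition is imposed on the elements of \<open>E\<close>; as \<open>E\<close> is a union of conjugacy classes and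
  parity and cycle lengths are invariant under conjugation, this is the condition on the classes.
\<close>

definition splitting_equipment :: "nat \<Rightarrow> (nat \<Rightarrow> nat) set \<Rightarrow> bool" where
  "splitting_equipment d E \<longleftrightarrow>
    (\<forall>p\<in>E. (\<not> evenperm p \<and> distinct_cycle_lengths d p) \<or> (evenperm p \<and> no_even_cycle_lengths d p))"

end

theory Submission
  imports Defs Complex_Main
begin

text \<open>
  Let \<open>K\<close> be the group of the equipment \<open>E\<close>.  Conjugation by a letter permutes the letters of \<open>K\<close> as
  it permutes \<open>E\<close>, so the kernel of \<open>\<beta>\<close> is central and \<open>K\<close> is a central extension of the symmetric
  group.  In every central extension the commutator of lifts of two permutations depends on the
  permutations only, and on commuting permutations it is central and multiplicative in each argument.
  As \<open>d \<ge> 4\<close>, there are disjoint transpositions; all pairs of these are conjugate, so they share one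
  commutator \<open>c\<close>, and \<open>c\<^sup>2 = 1\<close> because the pair can be swapped.  Two permutations with disjoint
  supports then have commutator \<open>c\<close> if both are odd, and \<open>1\<close> otherwise.

  In every such extension the kernel meets the commutator subgroup in \<open>{1, c}\<close>, see
  \<open>kernel_inter_derived\<close>.  Modulo \<open>c\<close> the transpositions have lifts that conjugation permutes; they
  share a central square \<open>a\<close>.  A word in these lifts can be rewritten so that the largest point
  occurs in at most one letter, and by induction on the number of points a word of length \<open>2k\<close> over
  the identity is \<open>a\<^sup>k\<close>.  A commutator is such a word divided by \<open>a\<^sup>k\<close>, so it is trivial modulo \<open>c\<close>
  whenever it lies over the identity.  Hence the ambiguity index is the cardinality of \<open>{1, c}\<close>, and
  everything depends on whether \<open>c = 1\<close> in \<open>K\<close>.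

  If \<open>p \<in> E\<close> commutes with \<open>h\<close>, the letter of \<open>p\<close> commutes in \<open>K\<close> with the lifts of \<open>h\<close>.  When \<open>p\<close> is even
  with a cycle of even length, take this cycle as \<open>h\<close>; when \<open>p\<close> is odd with two cycles of the same
  length, take the involution that swaps them.  In both cases the commutator of lifts of \<open>p\<close> and \<open>h\<close> is
  \<open>c\<close> in every central extension (\<open>ex_comm_nonsplitting\<close>), so \<open>c = 1\<close> in \<open>K\<close>.

  Conversely, if \<open>p\<close> is even with cycles of odd lengths, or odd with cycles of distinct lengths, then
  lifts of \<open>p\<close> commute with the lifts of the centralizer of \<open>p\<close> in every central extension
  (\<open>comm_splitting\<close>).  If this holds for all of \<open>E\<close>, then over any central extension the elements of \<open>E\<close>
  have lifts that conjugation permutes, and these define a homomorphism from \<open>K\<close> that carries \<open>c\<close> to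
  \<open>c\<close>.  It remains to exhibit one extension with \<open>c \<noteq> 1\<close>: there the transposition of \<open>i\<close> and \<open>j\<close>
  lifts to the operator \<open>(\<gamma>\<^sub>i - \<gamma>\<^sub>j) / \<surd>2\<close> with \<open>\<gamma>\<^sub>i\<close> anticommuting involutions, and \<open>c = -1\<close>.
\<close>

section \<open>Commutators of lifts in a central extension\<close>

lemma (in group) inv_mult_cancel [simp]:
  assumes "x \<in> carrier G" "y \<in> carrier G"
  shows "inv x \<otimes> (x \<otimes> y) = y" "x \<otimes> (inv x \<otimes> y) = y"
  using assms by (simp_all add: m_assoc[symmetric])

text \<open>
  Two disjoint transpositions exist only for \<open>d \<ge> 4\<close>, and all arguments below rest on the commutator
  of their lifts.
\<close>

locale symmetric_central_extension = group G for G (structure) +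
  fixes d :: nat and proj :: "'a \<Rightarrow> nat \<Rightarrow> nat"
  assumes four_le: "4 \<le> d"
    and proj_hom: "proj \<in> hom G (sym_group d)"
    and proj_surj: "p permutes {1..d} \<Longrightarrow> \<exists>x\<in>carrier G. proj x = p"
    and kernel_central:
      "\<lbrakk>x \<in> carrier G; proj x = id; y \<in> carrier G\<rbrakk> \<Longrightarrow> x \<otimes> y = y \<otimes> x"
begin

lemma proj_permutes: "x \<in> carrier G \<Longrightarrow> proj x permutes {1..d}"
  using proj_hom by (auto simp: hom_def sym_group_def)

lemma proj_mult [simp]:
  "\<lbrakk>x \<in> carrier G; y \<in> carrier G\<rbrakk> \<Longrightarrow> proj (x \<otimes> y) = proj x \<circ> proj y"
  using proj_hom by (auto simp: hom_def sym_group_def)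

lemma proj_group_hom: "group_hom G (sym_group d) proj"
  using proj_hom sym_group_is_group is_group by (simp add: group_hom_def group_hom_axioms_def)

lemma proj_one [simp]: "proj \<one> = id"
  using group_hom.hom_one[OF proj_group_hom] by (simp add: sym_group_def)

lemma proj_inv [simp]: "x \<in> carrier G \<Longrightarrow> proj (inv x) = inv' (proj x)"
  using group_hom.hom_inv[OF proj_group_hom] proj_permutes
  by (simp add: sym_group_carrier)

lemma inv_comp_proj: "x \<in> carrier G \<Longrightarrow> inv' (proj x) \<circ> proj x = id"
  using proj_permutes permutes_inv_o(2) by blast

definition lift :: "(nat \<Rightarrow> nat) \<Rightarrow> 'a" where
  "lift p = (SOME x. x \<in> carrier G \<and> proj x = p)"

lemma lift:
  assumes "p permutes {1..d}"
  shows lift_closed [simp]: "lift p \<in> carrier G" and proj_lift [simp]: "proj (lift p) = p"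
  using someI_ex[of "\<lambda>x. x \<in> carrier G \<and> proj x = p"] proj_surj[OF assms]
  by (auto simp: lift_def)

text \<open>
  Two elements over the same permutation differ by a central factor, which conjugation cancels.
\<close>

lemma conj_eq_of_proj_eq:
  assumes "x \<in> carrier G" "y \<in> carrier G" "proj x = proj y" "g \<in> carrier G"
  shows "x \<otimes> g \<otimes> inv x = y \<otimes> g \<otimes> inv y"
proof -
  define z where "z = inv y \<otimes> x"
  have z: "z \<in> carrier G" "proj z = id"
    using assms inv_comp_proj by (simp_all add: z_def)
  have x: "x = y \<otimes> z" using assms by (simp add: z_def)
  have "x \<otimes> g \<otimes> inv x = y \<otimes> (z \<otimes> g) \<otimes> inv z \<otimes> inv y"
    using assms z by (simp add: x m_assoc inv_mult_group)
  also have "\<dots> = y \<otimes> g \<otimes> inv y"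
    using assms z by (subst kernel_central) (simp_all add: m_assoc)
  finally show ?thesis .
qed

text \<open>
  The value does not depend on the lifts that are chosen, by \<open>comm_eq\<close>.
\<close>

definition comm :: "(nat \<Rightarrow> nat) \<Rightarrow> (nat \<Rightarrow> nat) \<Rightarrow> 'a" where
  "comm p q = lift p \<otimes> lift q \<otimes> inv (lift p) \<otimes> inv (lift q)"

lemma comm_eq:
  assumes "x \<in> carrier G" "y \<in> carrier G"
  shows "comm (proj x) (proj y) = x \<otimes> y \<otimes> inv x \<otimes> inv y"
proof -
  define x' y' where "x' = lift (proj x)" and "y' = lift (proj y)"
  have c: "x' \<in> carrier G" "proj x' = proj x" "y' \<in> carrier G" "proj y' = proj y"
    using assms proj_permutes by (auto simp: x'_def y'_def)
  have "comm (proj x) (proj y) = x' \<otimes> y' \<otimes> inv x' \<otimes> inv y'"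
    by (simp add: comm_def x'_def y'_def)
  also have "\<dots> = (x \<otimes> y' \<otimes> inv x) \<otimes> inv y'"
    using assms c by (subst conj_eq_of_proj_eq[of x' x]) auto
  also have "\<dots> = x \<otimes> (y' \<otimes> inv x \<otimes> inv y')"
    using assms c by (simp add: m_assoc)
  also have "\<dots> = x \<otimes> (y \<otimes> inv x \<otimes> inv y)"
    using assms c by (subst conj_eq_of_proj_eq[of y' y]) auto
  finally show ?thesis using assms by (simp add: m_assoc)
qed

lemma comm_closed [simp]:
  "\<lbrakk>p permutes {1..d}; q permutes {1..d}\<rbrakk> \<Longrightarrow> comm p q \<in> carrier G"
  by (simp add: comm_def)

lemma proj_comm:
  assumes "p permutes {1..d}" "q permutes {1..d}" "p \<circ> q = q \<circ> p"
  shows "proj (comm p q) = id"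
proof -
  have "proj (comm p q) = q \<circ> (p \<circ> inv' p) \<circ> inv' q"
    using assms by (simp add: comm_def) (simp add: fun_eq_iff)
  then show ?thesis using assms by (simp add: permutes_inv_o)
qed

lemma comm_swap:
  assumes "x \<in> carrier G" "y \<in> carrier G" "proj x = p" "proj y = q"
  shows "x \<otimes> y = comm p q \<otimes> (y \<otimes> x)"
  using assms comm_eq[OF assms(1,2)] by (simp add: m_assoc)

lemma comm_eqI:
  assumes "x \<in> carrier G" "y \<in> carrier G" "z \<in> carrier G" "proj x = p" "proj y = q"
    and "x \<otimes> y = z \<otimes> (y \<otimes> x)"
  shows "comm p q = z"
  using assms(1-5) comm_eq[OF assms(1,2)] by (simp add: m_assoc assms(6))

lemma comm_central:
  assumes "p permutes {1..d}" "q permutes {1..d}" "p \<circ> q = q \<circ> p" "y \<in> carrier G"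
  shows "comm p q \<otimes> y = y \<otimes> comm p q"
  using kernel_central proj_comm assms by simp

lemma comm_mult_left:
  assumes p: "p permutes {1..d}" and p': "p' permutes {1..d}" and q: "q permutes {1..d}"
    and pq: "p \<circ> q = q \<circ> p" and p'q: "p' \<circ> q = q \<circ> p'"
  shows "comm (p \<circ> p') q = comm p q \<otimes> comm p' q"
proof (rule comm_eqI[of "lift p \<otimes> lift p'" "lift q"])
  let ?x = "lift p" and ?x' = "lift p'" and ?y = "lift q"
  have "?x \<otimes> ?x' \<otimes> ?y = ?x \<otimes> (comm p' q \<otimes> (?y \<otimes> ?x'))"
    using p p' q by (simp add: m_assoc comm_swap[of ?x' ?y p' q])
  also have "\<dots> = (comm p' q \<otimes> ?x) \<otimes> (?y \<otimes> ?x')"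
    using p p' q p'q by (simp add: comm_central m_assoc)
  also have "\<dots> = comm p' q \<otimes> (?x \<otimes> ?y) \<otimes> ?x'"
    using p p' q by (simp add: m_assoc)
  also have "\<dots> = comm p' q \<otimes> comm p q \<otimes> (?y \<otimes> (?x \<otimes> ?x'))"
    using p p' q by (simp add: m_assoc comm_swap[of ?x ?y p q])
  finally show "?x \<otimes> ?x' \<otimes> ?y = comm p q \<otimes> comm p' q \<otimes> (?y \<otimes> (?x \<otimes> ?x'))"
    using p p' q pq comm_central[of p q "comm p' q"] by simp
qed (use assms in auto)

lemma comm_antisym:
  assumes "p permutes {1..d}" "q permutes {1..d}"
  shows "comm p q \<otimes> comm q p = \<one>"
  using assms by (simp add: comm_def m_assoc)

lemma comm_self [simp]: "p permutes {1..d} \<Longrightarrow> comm p p = \<one>"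
  by (simp add: comm_def m_assoc)

lemma comm_id_left [simp]: "p permutes {1..d} \<Longrightarrow> comm id p = \<one>"
  by (rule comm_eqI[of \<one> "lift p"]) auto

lemma comm_conj:
  assumes p: "p permutes {1..d}" and q: "q permutes {1..d}" and r: "r permutes {1..d}"
    and pq: "p \<circ> q = q \<circ> p"
  shows "comm (r \<circ> p \<circ> inv' r) (r \<circ> q \<circ> inv' r) = comm p q"
proof (rule comm_eqI[of "lift r \<otimes> lift p \<otimes> inv (lift r)" "lift r \<otimes> lift q \<otimes> inv (lift r)"])
  let ?x = "lift p" and ?y = "lift q" and ?z = "lift r"
  have "?z \<otimes> ?x \<otimes> inv ?z \<otimes> (?z \<otimes> ?y \<otimes> inv ?z) = ?z \<otimes> (?x \<otimes> ?y) \<otimes> inv ?z"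
    using p q r by (simp add: m_assoc)
  also have "\<dots> = ?z \<otimes> (comm p q \<otimes> (?y \<otimes> ?x)) \<otimes> inv ?z"
    using p q by (simp add: comm_swap[of ?x ?y p q])
  also have "\<dots> = (comm p q \<otimes> ?z) \<otimes> (?y \<otimes> ?x) \<otimes> inv ?z"
    using p q r pq by (subst comm_central) (simp_all add: m_assoc)
  finally show "?z \<otimes> ?x \<otimes> inv ?z \<otimes> (?z \<otimes> ?y \<otimes> inv ?z) =
      comm p q \<otimes> (?z \<otimes> ?y \<otimes> inv ?z \<otimes> (?z \<otimes> ?x \<otimes> inv ?z))"
    using p q r by (simp add: m_assoc)
qed (use assms in auto)

end

section \<open>Commutators of disjoint permutations\<close>

text \<open>
  In particular, any two pairs of disjoint transpositions are conjugate.
\<close>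

lemma permutes_extending_lists:
  assumes "finite S" "distinct xs" "distinct ys" "length xs = length ys"
    and "set xs \<subseteq> S" "set ys \<subseteq> S"
  shows "\<exists>p. p permutes S \<and> map p xs = ys"
  using assms(4,2,3,5,6)
proof (induction xs ys rule: list_induct2)
  case Nil
  then show ?case by (auto intro: exI[of _ id])
next
  case (Cons x xs y ys)
  then obtain p where p: "p permutes S" "map p xs = ys" by auto
  let ?p = "transpose (p x) y \<circ> p"
  have "?p permutes S"
    using Cons.prems p permutes_in_image[OF p(1)]
    by (auto intro!: permutes_compose permutes_swap_id)
  moreover have "?p z = p z" if "z \<in> set xs" for z
  proof -
    have "p z \<noteq> p x"
      using that Cons.prems permutes_inj[OF p(1)] by (auto dest: injD)
    moreover have "p z \<noteq> y" using that Cons.prems p(2) by auto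
    ultimately show ?thesis by simp
  qed
  ultimately have "?p permutes S \<and> map ?p (x # xs) = y # ys" using p(2) by auto
  then show ?case by (rule exI[of _ ?p])
qed

lemma conj_transpose:
  assumes "bij p"
  shows "p \<circ> transpose a b \<circ> inv' p = transpose (p a) (p b)"
  using conjugation_of_cycle[of "[a, b]" p] assms
  by (cases "a = b") (auto simp: surj_iff[symmetric] bij_is_surj)

lemma disjoint_transposes_commute:
  assumes "distinct [a, b, a', b']"
  shows "transpose a b \<circ> transpose a' b' = transpose a' b' \<circ> transpose a b"
  using assms by (auto simp: fun_eq_iff transpose_def)

lemma disjoint_permutes_commute:
  assumes "p permutes A" "q permutes B" "A \<inter> B = {}"
  shows "p \<circ> q = q \<circ> p"
proof
  fix x
  show "(p \<circ> q) x = (q \<circ> p) x"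
    using assms permutes_in_image[OF assms(1), of x] permutes_in_image[OF assms(2), of x]
      permutes_not_in[OF assms(1)] permutes_not_in[OF assms(2)]
    by (cases "x \<in> A"; cases "x \<in> B") (auto simp: disjoint_iff)
qed

context symmetric_central_extension
begin

text \<open>
  By \<open>comm_disjoint_transposes\<close> every other pair of disjoint transpositions gives the same element.
\<close>

definition c :: 'a where
  "c = comm (transpose 1 2) (transpose 3 4)"

lemma c_closed [simp]: "c \<in> carrier G"
  using four_le by (auto simp: c_def intro!: comm_closed permutes_swap_id)

lemma proj_c [simp]: "proj c = id"
  using four_le unfolding c_def
  by (intro proj_comm permutes_swap_id disjoint_transposes_commute) auto

lemma c_central: "x \<in> carrier G \<Longrightarrow> c \<otimes> x = x \<otimes> c"
  using kernel_central by simp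

lemma comm_disjoint_transposes:
  assumes "distinct [a, b, a', b']" "{a, b, a', b'} \<subseteq> {1..d}"
  shows "comm (transpose a b) (transpose a' b') = c"
proof -
  obtain r where r: "r permutes {1..d}" "map r [1, 2, 3, 4] = [a, b, a', b']"
    using permutes_extending_lists[of "{1..d}" "[1, 2, 3, 4]" "[a, b, a', b']"] assms four_le
    by auto
  have "comm (transpose a b) (transpose a' b') =
      comm (r \<circ> transpose 1 2 \<circ> inv' r) (r \<circ> transpose 3 4 \<circ> inv' r)"
    using r permutes_bij[OF r(1)] by (simp add: conj_transpose)
  also have "\<dots> = c"
    unfolding c_def using r(1) four_le
    by (intro comm_conj permutes_swap_id disjoint_transposes_commute) auto
  finally show ?thesis .
qed

text \<open>
  Swapping the two arguments inverts a commutator, but the swapped pair is again a pair of disjoint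
  transpositions.
\<close>

lemma c_square [simp]: "c \<otimes> c = \<one>"
proof -
  have "comm (transpose 1 2) (transpose 3 4) \<otimes> comm (transpose 3 4) (transpose 1 2) = \<one>"
    using four_le by (intro comm_antisym permutes_swap_id) auto
  moreover have "comm (transpose 3 4) (transpose 1 2) = c"
    using four_le by (intro comm_disjoint_transposes) auto
  ultimately show ?thesis by (simp add: c_def)
qed

definition c_if :: "bool \<Rightarrow> 'a" where
  "c_if b = (if b then c else \<one>)"

lemma c_if_closed [simp]: "c_if b \<in> carrier G"
  by (simp add: c_if_def)

lemma c_if_mult: "c_if a \<otimes> c_if b = c_if (a \<noteq> b)"
  by (simp add: c_if_def)

lemma comm_commute:
  assumes "p permutes {1..d}" "q permutes {1..d}" "comm p q = c_if b"
  shows "comm q p = c_if b"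
proof -
  have "c_if b \<otimes> comm q p = c_if b \<otimes> c_if b"
    using comm_antisym[OF assms(1,2)] assms(3) by (simp add: c_if_mult c_if_def)
  then show ?thesis using assms by simp
qed

text \<open>
  Write both permutations as products of transpositions of their supports: by multiplicativity \<open>c\<close>
  occurs once for each pair of factors, and only the parity of the number of pairs matters.
\<close>

lemma comm_disjoint:
  assumes p: "p permutes A" and q: "q permutes B" and AB: "A \<inter> B = {}"
    and sub: "A \<subseteq> {1..d}" "B \<subseteq> {1..d}"
  shows "comm p q = c_if (\<not> evenperm p \<and> \<not> evenperm q)"
proof -
  have fin: "finite A" "finite B" by (rule finite_subset[OF sub(1)], simp) (rule finite_subset[OF sub(2)], simp)
  have on: "r permutes {1..d}" if "r permutes A \<or> r permutes B" for r
    using that sub by (auto intro: permutes_subset)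
  have step: "comm (transpose a b) q = c_if (\<not> evenperm q)"
    if ab: "a \<in> A" "b \<in> A" "a \<noteq> b" for a b
    using q fin(2)
  proof (induction q rule: permutes_induct)
    case id
    have t: "transpose a b permutes {1..d}" using ab by (simp only: on permutes_swap_id simp_thms)
    have "comm id (transpose a b) = c_if False"
      using comm_id_left[OF t] by (simp add: c_if_def)
    then have "comm (transpose a b) id = c_if False"
      by (rule comm_commute[OF permutes_id t])
    then show ?case by (simp only: evenperm_id simp_thms)
  next
    case (swap a' b' q)
    have t: "transpose a b permutes {1..d}" "transpose a' b' permutes {1..d}"
      using ab swap(1,2) by (simp_all only: on permutes_swap_id simp_thms)
    have "comm (transpose a' b' \<circ> q) (transpose a b) =
        comm (transpose a' b') (transpose a b) \<otimes> comm q (transpose a b)"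
      using t swap on[of q] ab AB
      by (intro comm_mult_left disjoint_permutes_commute[of _ B _ A])
        (auto intro: permutes_swap_id)
    also have "comm (transpose a' b') (transpose a b) = c"
      using ab swap AB sub by (intro comm_disjoint_transposes) auto
    also have "comm q (transpose a b) = c_if (\<not> evenperm q)"
      by (rule comm_commute) (use swap t on in auto)
    also have "c \<otimes> c_if (\<not> evenperm q) = c_if (\<not> evenperm (transpose a' b' \<circ> q))"
      using swap permutation_permutes fin
      by (subst evenperm_comp) (auto simp: permutation_swap_id evenperm_swap c_if_def)
    finally have "comm (transpose a' b' \<circ> q) (transpose a b) =
        c_if (\<not> evenperm (transpose a' b' \<circ> q))" .
    moreover have "q permutes {1..d}" by (intro on disjI2) fact
    ultimately show ?case using t by (intro comm_commute[OF permutes_compose])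
  qed
  show ?thesis
    using p fin(1)
  proof (induction p rule: permutes_induct)
    case id
    then show ?case
      by (simp only: comm_id_left[OF on[OF disjI2[OF q]]] c_if_def evenperm_id simp_thms if_False)
  next
    case (swap a b p)
    have "comm (transpose a b \<circ> p) q = comm (transpose a b) q \<otimes> comm p q"
      using swap q AB
      by (intro comm_mult_left disjoint_permutes_commute[of _ A _ B] on)
        (auto intro: permutes_swap_id)
    also have "\<dots> = c_if (\<not> evenperm (transpose a b \<circ> p) \<and> \<not> evenperm q)"
      using swap permutation_permutes fin
      by (subst evenperm_comp)
        (auto simp: step permutation_swap_id evenperm_swap c_if_mult intro!: arg_cong[of _ _ c_if])
    finally show ?case .
  qed
qed

text \<open>
  A permutation that centralizes the transposition of \<open>1\<close> and \<open>2\<close> is, up to that transposition,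
  supported on the other points.  This is what makes conjugates of a lift of a transposition unique
  up to \<open>c\<close>.
\<close>

lemma comm_transpose_mem:
  assumes h: "h permutes {1..d}" and hc: "h \<circ> transpose 1 2 = transpose 1 2 \<circ> h"
  shows "comm h (transpose 1 2) \<in> {\<one>, c}"
proof -
  let ?t = "transpose 1 2 :: nat \<Rightarrow> nat"
  have t: "?t permutes {1..d}" using four_le by (intro permutes_swap_id) auto
  have "transpose (h 1) (h 2) = h \<circ> ?t \<circ> inv' h"
    by (rule conj_transpose[symmetric]) (rule permutes_bij[OF h])
  also have "\<dots> = ?t \<circ> (h \<circ> inv' h)" using hc by (simp only: comp_assoc[symmetric])
  finally have "transpose (h 1) (h 2) = ?t" using h by (simp add: permutes_inv_o)
  then have h12: "h 1 = 1 \<and> h 2 = 2 \<or> h 1 = 2 \<and> h 2 = 1"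
    by (metis transpose_apply_first transpose_apply_other transpose_eq_imp_eq
        transpose_apply_second one_eq_numeral_iff num.distinct(1))
  have mem: "comm k ?t \<in> {\<one>, c}"
    if k: "k permutes {1..d}" "k 1 = 1" "k 2 = 2" for k
  proof -
    have "k permutes {3..d}"
    proof (rule permutes_superset[OF k(1)])
      fix x assume "x \<in> {1..d} - {3..d}"
      then have "x = 1 \<or> x = 2" by auto
      then show "k x = x" using k by auto
    qed
    then have "comm k ?t = c_if (\<not> evenperm k \<and> \<not> evenperm ?t)"
      using four_le by (intro comm_disjoint[of _ "{3..d}" _ "{1, 2}"] permutes_swap_id) auto
    then show ?thesis by (simp add: c_if_def)
  qed
  show ?thesis
  proof (cases "h 1 = 1")
    case True
    then show ?thesis using mem h h12 by auto
  next
    case False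
    define k where "k = ?t \<circ> h"
    have k: "k permutes {1..d}" "k 1 = 1" "k 2 = 2"
      using h t h12 False by (auto simp: k_def intro: permutes_compose)
    have h_eq: "h = ?t \<circ> k" by (simp add: k_def fun_eq_iff)
    have "k \<circ> ?t = ?t \<circ> k" using hc by (simp add: k_def comp_assoc)
    then have "comm h ?t = comm ?t ?t \<otimes> comm k ?t"
      unfolding h_eq by (intro comm_mult_left t k) auto
    then show ?thesis using mem[OF k] t k by simp
  qed
qed

end

section \<open>Words in lifts of transpositions\<close>

definition transps :: "nat \<Rightarrow> (nat \<Rightarrow> nat) set" where
  "transps n = {transpose i j | i j. i \<in> {1..n} \<and> j \<in> {1..n} \<and> i \<noteq> j}"

definition perm_of :: "(nat \<Rightarrow> nat) list \<Rightarrow> nat \<Rightarrow> nat" where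
  "perm_of w = foldr (\<circ>) w id"

lemma perm_of_simps [simp]:
  "perm_of [] = id" "perm_of (t # w) = t \<circ> perm_of w" "perm_of (v @ w) = perm_of v \<circ> perm_of w"
proof -
  show "perm_of (v @ w) = perm_of v \<circ> perm_of w"
    by (induction v) (simp_all add: perm_of_def comp_assoc)
qed (simp_all add: perm_of_def)

lemma transps_mono: "m \<le> n \<Longrightarrow> transps m \<subseteq> transps n"
  by (fastforce simp: transps_def)

lemma transps_permutes: "t \<in> transps n \<Longrightarrow> t permutes {1..n}"
  by (auto simp: transps_def intro: permutes_swap_id)

lemma transps_involution: "t \<in> transps n \<Longrightarrow> t \<circ> t = id"
  by (auto simp: transps_def)

lemma perm_of_permutes: "w \<in> lists (transps n) \<Longrightarrow> perm_of w permutes {1..n}"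
proof (induction w)
  case (Cons t w)
  then have "perm_of w permutes {1..n}" by simp
  moreover have "t permutes {1..n}" by (rule transps_permutes) (use Cons in simp)
  ultimately show ?case by (simp only: perm_of_simps permutes_compose)
qed simp

lemma perm_of_rev: "w \<in> lists (transps n) \<Longrightarrow> perm_of (rev w) = inv' (perm_of w)"
proof (induction w)
  case (Cons t w)
  then have "bij t" "bij (perm_of w)" "inv' t = t"
    using permutes_bij[OF transps_permutes] permutes_bij[OF perm_of_permutes]
    by (auto simp: transps_def)
  moreover have "perm_of (rev w) = inv' (perm_of w)" using Cons by simp
  ultimately show ?case by (simp only: rev.simps perm_of_simps o_inv_distrib comp_id)
qed simp

lemma ex_perm_of:
  assumes "p permutes {1..d}"
  shows "\<exists>w\<in>lists (transps d). perm_of w = p"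
  using assms finite_atLeastAtMost
proof (induction p rule: permutes_induct)
  case id
  then show ?case by (intro bexI[of _ "[]"]) auto
next
  case (swap a b p)
  then obtain w where "w \<in> lists (transps d)" "perm_of w = p" by blast
  moreover have "transpose a b \<in> transps d" using swap by (auto simp: transps_def)
  ultimately show ?case by (intro bexI[of _ "transpose a b # w"]) auto
qed

lemma conj_transps:
  assumes "s \<in> transps d" "t \<in> transps d"
  shows "s \<circ> t \<circ> s \<in> transps d"
proof -
  obtain i j where t: "t = transpose i j" "i \<in> {1..d}" "j \<in> {1..d}" "i \<noteq> j"
    using assms(2) by (auto simp: transps_def)
  have s: "bij s" "inv' s = s" "s permutes {1..d}"
    using assms(1) transps_permutes[OF assms(1)] by (auto simp: transps_def)
  then have "s \<circ> t \<circ> s = transpose (s i) (s j)"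
    using conj_transpose[OF s(1), of i j] t by simp
  moreover have "s i \<noteq> s j" using t(4) s(1) by (simp add: bij_is_inj inj_eq)
  moreover have "s i \<in> {1..d}" "s j \<in> {1..d}"
    using t permutes_in_image[OF s(3)] by blast+
  ultimately show ?thesis unfolding transps_def by blast
qed

lemma rev_in_lists [simp]: "rev w \<in> lists A \<longleftrightarrow> w \<in> lists A"
  by (simp add: in_lists_conv_set)

text \<open>
  Lifts of transpositions that are permuted by conjugation and have a common square.
\<close>

locale transposition_system = group Q for Q (structure) +
  fixes d :: nat and T :: "(nat \<Rightarrow> nat) \<Rightarrow> 'a" and a :: 'a
  assumes T_closed [simp]: "t \<in> transps d \<Longrightarrow> T t \<in> carrier Q"
    and a_closed [simp]: "a \<in> carrier Q"
    and T_square: "t \<in> transps d \<Longrightarrow> T t \<otimes> T t = a"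
    and T_conj: "\<lbrakk>s \<in> transps d; t \<in> transps d\<rbrakk> \<Longrightarrow> T s \<otimes> T t = T (s \<circ> t \<circ> s) \<otimes> T s"
begin

definition T_of :: "(nat \<Rightarrow> nat) list \<Rightarrow> 'a" where
  "T_of w = foldr (\<lambda>t x. T t \<otimes> x) w \<one>"

lemma T_of_closed [simp]: "w \<in> lists (transps d) \<Longrightarrow> T_of w \<in> carrier Q"
  by (induction w) (simp_all add: T_of_def)

lemma T_of_simps [simp]: "T_of [] = \<one>" "T_of (t # w) = T t \<otimes> T_of w"
  by (simp_all add: T_of_def)

lemma T_of_append [simp]:
  "\<lbrakk>v \<in> lists (transps d); w \<in> lists (transps d)\<rbrakk> \<Longrightarrow> T_of (v @ w) = T_of v \<otimes> T_of w"
  by (induction v) (simp_all add: m_assoc)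

lemma a_commutes: "w \<in> lists (transps d) \<Longrightarrow> a \<otimes> T_of w = T_of w \<otimes> a"
proof (induction w)
  case (Cons t w)
  then have t: "t \<in> transps d" and w: "w \<in> lists (transps d)" by auto
  have "a \<otimes> T t = T t \<otimes> a" using t by (simp add: T_square[OF t, symmetric] m_assoc)
  then have "a \<otimes> T_of (t # w) = T t \<otimes> (a \<otimes> T_of w)"
    using t w by (simp add: m_assoc[symmetric])
  then show ?case using t w Cons by (simp add: m_assoc)
qed simp

lemma a_pow_commutes: "w \<in> lists (transps d) \<Longrightarrow> a [^] (k::nat) \<otimes> T_of w = T_of w \<otimes> a [^] k"
proof (induction k)
  case (Suc k)
  have "a [^] Suc k \<otimes> T_of w = (a [^] k \<otimes> T_of w) \<otimes> a"
    using Suc.prems by (simp add: m_assoc a_commutes)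
  also have "\<dots> = T_of w \<otimes> a [^] k \<otimes> a" using Suc by simp
  also have "\<dots> = T_of w \<otimes> a [^] Suc k" using Suc.prems by (simp add: m_assoc)
  finally show ?case .
qed simp

text \<open>
  The word \<open>w\<close> can be replaced by \<open>v\<close> at the price of a factor \<open>a\<close> for every two letters that get lost.
\<close>

definition reduces :: "(nat \<Rightarrow> nat) list \<Rightarrow> (nat \<Rightarrow> nat) list \<Rightarrow> bool" where
  "reduces w v \<longleftrightarrow> perm_of w = perm_of v \<and>
    (\<exists>k. length w = length v + 2 * k \<and> T_of w = T_of v \<otimes> a [^] k)"

lemma reduces_refl: "w \<in> lists (transps d) \<Longrightarrow> reduces w w"
  by (simp add: reduces_def)

lemma reduces_trans:
  assumes "reduces u v" "reduces v w" "w \<in> lists (transps d)"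
  shows "reduces u w"
proof -
  obtain k where k: "length u = length v + 2 * k" "T_of u = T_of v \<otimes> a [^] k"
    using assms unfolding reduces_def by blast
  obtain l where l: "length v = length w + 2 * l" "T_of v = T_of w \<otimes> a [^] l"
    using assms unfolding reduces_def by blast
  show ?thesis
    unfolding reduces_def using assms k l
    by (intro conjI exI[of _ "l + k"]) (auto simp: reduces_def m_assoc nat_pow_mult)
qed

lemma reduces_append:
  assumes "reduces v v'" "u \<in> lists (transps d)" "v \<in> lists (transps d)"
    "v' \<in> lists (transps d)" "w \<in> lists (transps d)"
  shows "reduces (u @ v @ w) (u @ v' @ w)"
proof -
  obtain k where k: "length v = length v' + 2 * k" "T_of v = T_of v' \<otimes> a [^] k"
    using assms unfolding reduces_def by blast
  have "T_of (u @ v @ w) = T_of u \<otimes> (T_of v' \<otimes> (a [^] k \<otimes> T_of w))"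
    using assms k by (simp add: m_assoc)
  also have "\<dots> = T_of (u @ v' @ w) \<otimes> a [^] k"
    using assms by (simp add: m_assoc a_pow_commutes)
  finally show ?thesis
    using assms k by (auto simp: reduces_def)
qed

lemma reduces_square: "t \<in> transps d \<Longrightarrow> reduces [t, t] []"
  unfolding reduces_def
  by (intro conjI exI[of _ "Suc 0"]) (auto simp: T_square transps_involution)

lemma reduces_exchange:
  assumes "s \<in> transps d" "t \<in> transps d" "s \<circ> t = u \<circ> s"
  shows "reduces [s, t] [u, s]"
proof -
  have u: "u = s \<circ> t \<circ> s"
    using assms(3) transps_involution[OF assms(1)] by (simp add: comp_assoc)
  show ?thesis
    unfolding reduces_def
  proof (intro conjI exI[of _ "0::nat"])
    have "T s \<otimes> T t = T u \<otimes> T s" unfolding u by (rule T_conj) fact+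
    moreover have "u \<in> transps d" unfolding u using conj_transps assms(1,2) .
    ultimately show "T_of [s, t] = T_of [u, s] \<otimes> a [^] (0::nat)"
      using assms(1,2) by simp
  qed (simp_all add: assms(3))
qed

lemma reduces_exchange':
  assumes "s \<in> transps d" "t \<in> transps d" "u \<in> transps d" "s \<circ> t = t \<circ> u"
  shows "reduces [s, t] [t, u]"
proof -
  have s: "s = t \<circ> u \<circ> t"
    using assms(4) transps_involution[OF assms(2)]
    by (metis comp_assoc comp_id)
  have "T t \<otimes> T u = T s \<otimes> T t" using assms by (simp add: T_conj s)
  then show ?thesis
    unfolding reduces_def using assms
    by (intro conjI exI[of _ "0::nat"]) auto
qed

text \<open>
  The letters that move the last point \<open>m\<close> are pushed to the right end.  There two of them merge into
  one, since \<open>(i m)(j m) = (i j)(i m)\<close>, or cancel to \<open>a\<close> if they are equal.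
\<close>

lemma reduces_split_last:
  assumes "Suc n \<le> d" "w \<in> lists (transps (Suc n))"
  shows "\<exists>v\<in>lists (transps n). \<exists>e \<in> insert [] ((\<lambda>i. [transpose i (Suc n)]) ` {1..n}).
    reduces w (v @ e)"
  using assms(2)
proof (induction w rule: rev_induct)
  case Nil
  then show ?case by (intro bexI[of _ "[]"]) (auto intro: reduces_refl)
next
  case (snoc t w)
  let ?m = "Suc n"
  have sub: "transps n \<subseteq> transps d" "transps ?m \<subseteq> transps d"
    using assms(1) by (auto intro!: transps_mono)
  have last: "transpose i ?m \<in> transps d" if "i \<in> {1..n}" for i
    using that assms(1) by (fastforce simp: transps_def)
  have t: "t \<in> transps ?m" and w: "w \<in> lists (transps ?m)" using snoc by auto
  obtain v e where v: "v \<in> lists (transps n)"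
    and e: "e \<in> insert [] ((\<lambda>i. [transpose i ?m]) ` {1..n})" and r: "reduces w (v @ e)"
    using snoc.IH[OF w] by blast
  have vd: "v \<in> lists (transps d)" and wd: "w \<in> lists (transps d)" and td: "t \<in> transps d"
    using v w t sub by auto
  have ed: "e \<in> lists (transps d)" using e last by auto
  have r: "reduces (w @ [t]) (v @ e @ [t])"
    using reduces_append[OF r, of "[]" "[t]"] vd wd td ed by simp
  have step: ?case
    if "reduces (e @ [t]) (x @ e')" "x \<in> lists (transps n)"
      "e' \<in> insert [] ((\<lambda>i. [transpose i ?m]) ` {1..n})" for x e'
  proof -
    have d: "x \<in> lists (transps d)" "e' \<in> lists (transps d)"
      using that sub last by auto
    have "reduces (v @ e @ [t]) (v @ x @ e')"
      using reduces_append[OF that(1), of v "[]"] vd d ed td by simp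
    then have "reduces (w @ [t]) ((v @ x) @ e')"
      using reduces_trans[OF r] vd d by simp
    then show ?thesis using v that(2,3) by (intro bexI[of _ "v @ x"] bexI[of _ e']) auto
  qed
  obtain j k where jk: "t = transpose j k" "j \<in> {1..n}" "k \<in> {1..?m}" "j \<noteq> k"
  proof -
    obtain j k where "t = transpose j k" "j \<in> {1..?m}" "k \<in> {1..?m}" "j \<noteq> k"
      using t by (auto simp: transps_def)
    then show thesis
      using that[of j k] that[of k j] by (cases "j = ?m") (auto simp: transpose_commute)
  qed
  show ?case
  proof (cases "e = []")
    case True
    show ?thesis
    proof (cases "k = ?m")
      case True
      then show ?thesis using step[of "[]" "[t]"] \<open>e = []\<close> jk reduces_refl[of "[t]"] td by auto
    next
      case False
      then have "k \<in> {1..n}" using jk(3) by auto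
      then have "t \<in> transps n" using jk by (auto simp: transps_def)
      then show ?thesis using step[of "[t]" "[]"] \<open>e = []\<close> reduces_refl[of "[t]"] td by auto
    qed
  next
    case False
    then obtain i where i: "i \<in> {1..n}" "e = [transpose i ?m]" using e by auto
    show ?thesis
    proof (cases "k = ?m")
      case k: True
      show ?thesis
      proof (cases "j = i")
        case True
        then show ?thesis
          using step[of "[]" "[]"] i jk k reduces_square[OF td] by auto
      next
        case False
        have "transpose i ?m \<circ> t = transpose i j \<circ> transpose i ?m"
          using False i jk k by (auto simp: fun_eq_iff transpose_def)
        then have "reduces (e @ [t]) [transpose i j, transpose i ?m]"
          using reduces_exchange[OF last td] i by simp
        moreover have "transpose i j \<in> transps n" using i jk False by (auto simp: transps_def)
        ultimately show ?thesis using step[of "[transpose i j]" "[transpose i ?m]"] i by auto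
      qed
    next
      case False
      have "k \<in> {1..n}" using False jk(3) by auto
      then have tn: "t \<in> transps n" using jk by (auto simp: transps_def)
      have ti: "t i \<in> {1..n}" "t ?m = ?m"
        using permutes_in_image[OF transps_permutes[OF tn], of i] i
          permutes_not_in[OF transps_permutes[OF tn], of ?m] by auto
      have "t \<circ> transpose (t i) ?m \<circ> inv' t = transpose (t (t i)) (t ?m)"
        by (rule conj_transpose) (rule permutes_bij[OF transps_permutes[OF tn]])
      then have "t \<circ> transpose (t i) ?m \<circ> t = transpose i ?m"
        using ti jk by simp
      then have "transpose i ?m \<circ> t = t \<circ> transpose (t i) ?m"
        using transps_involution[OF tn] by (metis comp_assoc comp_id)
      then have "reduces (e @ [t]) [t, transpose (t i) ?m]"
        using reduces_exchange'[OF last td last] i ti by simp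
      then show ?thesis using step[of "[t]" "[transpose (t i) ?m]"] ti(1) tn by auto
    qed
  qed
qed

text \<open>
  A letter that moves the last point cannot survive over the identity, so the word reduces to one on
  fewer points.
\<close>

lemma reduces_Nil:
  assumes "n \<le> d" "w \<in> lists (transps n)" "perm_of w = id"
  shows "reduces w []"
  using assms
proof (induction n arbitrary: w)
  case 0
  then have "w = []" by (cases w) (auto simp: transps_def)
  then show ?case by (simp add: reduces_refl)
next
  case (Suc n)
  obtain v e where v: "v \<in> lists (transps n)"
    and e: "e \<in> insert [] ((\<lambda>i. [transpose i (Suc n)]) ` {1..n})" and r: "reduces w (v @ e)"
    using reduces_split_last[OF Suc.prems(1,2)] by blast
  have p: "perm_of (v @ e) = id" using r Suc.prems(3) unfolding reduces_def by metis
  have "e = []"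
  proof (rule ccontr)
    assume "e \<noteq> []"
    then obtain i where i: "i \<in> {1..n}" "e = [transpose i (Suc n)]" using e by auto
    have "perm_of v (Suc n) = Suc n"
      using permutes_not_in[OF perm_of_permutes[OF v]] by auto
    moreover have "perm_of v (Suc n) = i" using p i by (auto dest: fun_cong[of _ _ i])
    ultimately show False using i by simp
  qed
  then have "reduces v []" using Suc.IH[OF _ v] Suc.prems(1) p by (metis Suc_leD append_Nil2)
  then show ?case using reduces_trans[OF r, of "[]"] \<open>e = []\<close> by simp
qed

text \<open>
  A word divided by the power of \<open>a\<close> that makes its degree zero, when each \<open>T t\<close> is given degree \<open>1\<close>
  and \<open>a\<close> degree \<open>2\<close>.  Commutators are of this kind, as the inverse of \<open>T t\<close> is \<open>T t\<close> divided by \<open>a\<close>.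
\<close>

definition balanced :: "'a \<Rightarrow> (nat \<Rightarrow> nat) \<Rightarrow> bool" where
  "balanced x p \<longleftrightarrow> x \<in> carrier Q \<and>
    (\<exists>w\<in>lists (transps d). \<exists>k. perm_of w = p \<and> length w = 2 * k \<and> x \<otimes> a [^] k = T_of w)"

lemma balanced_over_id: "balanced x id \<Longrightarrow> x = \<one>"
proof -
  assume "balanced x id"
  then obtain w k where w: "w \<in> lists (transps d)" "perm_of w = id" "length w = 2 * k"
    "x \<otimes> a [^] k = T_of w" and x: "x \<in> carrier Q"
    by (auto simp: balanced_def)
  have "reduces w []" using reduces_Nil[of d w] w by simp
  then have "x \<otimes> a [^] k = \<one> \<otimes> a [^] k" using w by (auto simp: reduces_def)
  then show ?thesis using x by simp
qed

lemma T_of_rev: "w \<in> lists (transps d) \<Longrightarrow> T_of w \<otimes> T_of (rev w) = a [^] length w"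
proof (induction w)
  case (Cons t w)
  then have t: "t \<in> transps d" and w: "w \<in> lists (transps d)" by auto
  have "T_of (t # w) \<otimes> T_of (rev (t # w)) = T t \<otimes> (T_of w \<otimes> T_of (rev w)) \<otimes> T t"
    using t w by (simp add: m_assoc)
  also have "\<dots> = T t \<otimes> (a [^] length w \<otimes> T_of [t])" using t w Cons by (simp add: m_assoc)
  also have "\<dots> = T t \<otimes> T t \<otimes> a [^] length w"
    using t by (subst a_pow_commutes) (simp_all add: m_assoc)
  also have "\<dots> = a [^] Suc (length w)" using t nat_pow_Suc2[of a] by (simp only: T_square a_closed)
  finally show ?case by simp
qed simp

lemma T_of_rev': "w \<in> lists (transps d) \<Longrightarrow> T_of (rev w) = inv (T_of w) \<otimes> a [^] length w"
  by (simp add: T_of_rev[symmetric])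

lemma balanced_one: "balanced \<one> id"
  unfolding balanced_def by (intro conjI bexI[of _ "[]"] exI[of _ "0::nat"]) auto

lemma balanced_mult:
  assumes "balanced x p" "balanced y q"
  shows "balanced (x \<otimes> y) (p \<circ> q)"
proof -
  obtain v k where v: "v \<in> lists (transps d)" "perm_of v = p" "length v = 2 * k"
    "x \<otimes> a [^] k = T_of v" and x: "x \<in> carrier Q"
    using assms(1) by (auto simp: balanced_def)
  obtain w l where w: "w \<in> lists (transps d)" "perm_of w = q" "length w = 2 * l"
    "y \<otimes> a [^] l = T_of w" and y: "y \<in> carrier Q"
    using assms(2) by (auto simp: balanced_def)
  have "T_of (v @ w) = x \<otimes> (a [^] k \<otimes> T_of w)"
    using v w x by (simp flip: v(4) add: m_assoc)
  also have "\<dots> = x \<otimes> (y \<otimes> a [^] l) \<otimes> a [^] k"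
    using w x y by (simp add: a_pow_commutes m_assoc)
  also have "\<dots> = x \<otimes> y \<otimes> a [^] (k + l)"
    using x y by (simp add: m_assoc nat_pow_mult add.commute)
  finally show ?thesis
    unfolding balanced_def using v w x y
    by (intro conjI bexI[of _ "v @ w"] exI[of _ "k + l"]) auto
qed

lemma balanced_inv:
  assumes "balanced x p"
  shows "balanced (inv x) (inv' p)"
proof -
  obtain w k where w: "w \<in> lists (transps d)" "perm_of w = p" "length w = 2 * k"
    "x \<otimes> a [^] k = T_of w" and x: "x \<in> carrier Q"
    using assms by (auto simp: balanced_def)
  have "T_of (rev w) = inv (x \<otimes> a [^] k) \<otimes> a [^] (k + k)"
    using T_of_rev'[OF w(1)] w by (simp add: mult_2)
  also have "\<dots> = inv (a [^] k) \<otimes> (inv x \<otimes> a [^] k) \<otimes> a [^] k"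
    using x by (simp add: inv_mult_group m_assoc nat_pow_mult)
  finally have "a [^] k \<otimes> T_of (rev w) = inv x \<otimes> a [^] k \<otimes> a [^] k"
    using x by (simp add: m_assoc)
  then have "T_of (rev w) = inv x \<otimes> a [^] k"
    using x w by (simp add: a_pow_commutes)
  then show ?thesis
    unfolding balanced_def using w x
    by (intro conjI bexI[of _ "rev w"] exI[of _ k]) (auto simp: perm_of_rev)
qed

lemma balanced_commutator:
  assumes v: "v \<in> lists (transps d)" and w: "w \<in> lists (transps d)"
  shows "balanced (T_of v \<otimes> T_of w \<otimes> inv (T_of v) \<otimes> inv (T_of w))
    (perm_of v \<circ> perm_of w \<circ> inv' (perm_of v) \<circ> inv' (perm_of w))"
proof -
  let ?V = "T_of v" and ?W = "T_of w" and ?k = "length v" and ?l = "length w"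
  have V: "?V \<in> carrier Q" and W: "?W \<in> carrier Q" using v w by auto
  have comm: "a [^] ?k \<otimes> inv ?W = inv ?W \<otimes> a [^] ?k"
  proof -
    have "?W \<otimes> (a [^] ?k \<otimes> inv ?W) = a [^] ?k"
      using W a_pow_commutes[OF w, of ?k] by (simp add: m_assoc[symmetric] flip: a_pow_commutes[OF w])
        (simp add: m_assoc)
    then show ?thesis using W by (metis inv_mult_cancel(1) inv_closed m_closed nat_pow_closed a_closed)
  qed
  have "T_of (v @ w @ rev v @ rev w) =
      ?V \<otimes> (?W \<otimes> (inv ?V \<otimes> (a [^] ?k \<otimes> inv ?W \<otimes> a [^] ?l)))"
    using v w V W by (simp add: T_of_rev' m_assoc)
  also have "\<dots> = ?V \<otimes> ?W \<otimes> inv ?V \<otimes> inv ?W \<otimes> a [^] (?k + ?l)"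
    using V W by (simp add: comm m_assoc nat_pow_mult)
  finally show ?thesis
    unfolding balanced_def using v w V W
    by (intro conjI bexI[of _ "v @ w @ rev v @ rev w"] exI[of _ "?k + ?l"])
      (auto simp: perm_of_rev comp_assoc)
qed

end

section \<open>The kernel inside the commutator subgroup\<close>

declare mult_FactGroup [simp del] one_FactGroup [simp del]

context symmetric_central_extension
begin

definition c_group :: "'a set" where "c_group = {\<one>, c}"

lemma c_group_normal: "c_group \<lhd> G"
proof -
  have "subgroup c_group G"
    by (rule subgroupI) (auto simp: c_group_def inv_equality)
  then show ?thesis
    by (auto simp: normal_inv_iff c_group_def c_central m_assoc)
qed

abbreviation Quot where "Quot \<equiv> G Mod c_group"

abbreviation quot :: "'a \<Rightarrow> 'a set" where "quot x \<equiv> c_group #> x"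

lemma group_Quot: "group Quot"
  by (rule normal.factorgroup_is_group[OF c_group_normal])

lemma quot_hom: "group_hom G Quot quot"
  using normal.r_coset_hom_Mod[OF c_group_normal] group_Quot is_group
  by (simp add: group_hom_def group_hom_axioms_def)

lemma quot_mult: "\<lbrakk>x \<in> carrier G; y \<in> carrier G\<rbrakk> \<Longrightarrow> quot (x \<otimes> y) = quot x \<otimes>\<^bsub>Quot\<^esub> quot y"
  by (rule group_hom.hom_mult[OF quot_hom])

lemma quot_closed: "x \<in> carrier G \<Longrightarrow> quot x \<in> carrier Quot"
  by (rule group_hom.hom_closed[OF quot_hom])

lemma quot_eq_one_iff: "x \<in> carrier G \<Longrightarrow> quot x = \<one>\<^bsub>Quot\<^esub> \<longleftrightarrow> x \<in> c_group"
  using normal_imp_subgroup[OF c_group_normal]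
  by (metis coset_join1 coset_join2 one_FactGroup subgroup.subset)

definition t12 :: 'a where "t12 = lift (transpose 1 2)"

lemma t12: "t12 \<in> carrier G" "proj t12 = transpose 1 2"
  using four_le unfolding t12_def by (intro lift permutes_swap_id; simp)+

text \<open>
  Conjugates of one fixed lift, so that their images in the quotient by \<open>c\<close> are permuted by
  conjugation.  In the extension itself they are permuted only up to factors \<open>c\<close>.
\<close>

definition transp_lift :: "(nat \<Rightarrow> nat) \<Rightarrow> 'a" where
  "transp_lift t = (let g = SOME g. g \<in> carrier G \<and> proj g \<circ> transpose 1 2 \<circ> inv' (proj g) = t
    in g \<otimes> t12 \<otimes> inv g)"

lemma transp_lift_conj:
  assumes "t \<in> transps d"
  obtains g where "g \<in> carrier G" "proj g \<circ> transpose 1 2 \<circ> inv' (proj g) = t"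
    "transp_lift t = g \<otimes> t12 \<otimes> inv g"
proof -
  obtain i j where t: "t = transpose i j" "i \<in> {1..d}" "j \<in> {1..d}" "i \<noteq> j"
    using assms by (auto simp: transps_def)
  obtain p where p: "p permutes {1..d}" "map p [1, 2] = [i, j]"
    using permutes_extending_lists[of "{1..d}" "[1, 2]" "[i, j]"] t four_le by auto
  have "p \<circ> transpose 1 2 \<circ> inv' p = t"
    using conj_transpose[OF permutes_bij[OF p(1)], of 1 2] p t by simp
  then have "\<exists>g. g \<in> carrier G \<and> proj g \<circ> transpose 1 2 \<circ> inv' (proj g) = t"
    using p(1) by (intro exI[of _ "lift p"]) simp
  from someI_ex[OF this] show thesis
    by (intro that) (auto simp: transp_lift_def Let_def)
qed

lemma transp_lift_closed [simp]: "t \<in> transps d \<Longrightarrow> transp_lift t \<in> carrier G"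
  by (erule transp_lift_conj) (simp add: t12 del: One_nat_def)

lemma proj_transp_lift: "t \<in> transps d \<Longrightarrow> proj (transp_lift t) = t"
  by (erule transp_lift_conj) (simp add: t12 del: One_nat_def)

text \<open>
  Elements that conjugate the transposition in the same way differ by an element of its centralizer,
  and such an element moves the fixed lift by a factor \<open>1\<close> or \<open>c\<close> only.
\<close>

lemma quot_conj_t12_eq:
  assumes x: "x \<in> carrier G" and y: "y \<in> carrier G"
    and eq: "proj x \<circ> transpose 1 2 \<circ> inv' (proj x) = proj y \<circ> transpose 1 2 \<circ> inv' (proj y)"
  shows "quot (x \<otimes> t12 \<otimes> inv x) = quot (y \<otimes> t12 \<otimes> inv y)"
proof -
  let ?t = "transpose 1 2 :: nat \<Rightarrow> nat"
  define z where "z = inv y \<otimes> x"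
  define h where "h = proj z"
  have z: "z \<in> carrier G" and x_eq: "x = y \<otimes> z" using x y by (simp_all add: z_def)
  have h_eq: "h = inv' (proj y) \<circ> proj x" using x y by (simp add: h_def z_def)
  have h: "h permutes {1..d}" using z proj_permutes by (simp add: h_def)
  have "h \<circ> ?t = inv' (proj y) \<circ> (proj x \<circ> ?t \<circ> inv' (proj x)) \<circ> proj x"
    using inv_comp_proj[OF x] by (simp add: h_eq comp_assoc)
  also have "\<dots> = ?t \<circ> h"
    unfolding eq using inv_comp_proj[OF y] by (simp add: h_eq comp_assoc[symmetric])
  finally have "comm h ?t \<in> {\<one>, c}" by (intro comm_transpose_mem h)
  moreover have n: "comm h ?t = z \<otimes> t12 \<otimes> inv z \<otimes> inv t12"
    using comm_eq[OF z t12(1)] t12(2) by (simp add: h_def)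
  ultimately obtain n where n: "n \<in> {\<one>, c}" "n = z \<otimes> t12 \<otimes> inv z \<otimes> inv t12" by blast
  have nG: "n \<in> carrier G" using n(1) by auto
  have "x \<otimes> t12 \<otimes> inv x = y \<otimes> (n \<otimes> t12) \<otimes> inv y"
    using y z t12 by (simp add: x_eq n(2) m_assoc inv_mult_group)
  also have "\<dots> = n \<otimes> (y \<otimes> t12 \<otimes> inv y)"
  proof -
    have "n \<otimes> y = y \<otimes> n" using n(1) y c_central by auto
    then show ?thesis using y t12 nG by (simp add: m_assoc[symmetric])
  qed
  finally have "quot (x \<otimes> t12 \<otimes> inv x) = quot n \<otimes>\<^bsub>Quot\<^esub> quot (y \<otimes> t12 \<otimes> inv y)"
    using y t12 nG by (simp add: quot_mult)
  moreover have "quot n = \<one>\<^bsub>Quot\<^esub>" using n(1) nG quot_eq_one_iff by (simp add: c_group_def)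
  ultimately show ?thesis
    using y t12 group.is_monoid[OF group_Quot] quot_closed by (simp add: monoid.l_one)
qed

lemma quot_conj_transp_lift:
  assumes x: "x \<in> carrier G" and s: "s \<in> transps d" and t: "t \<in> transps d"
    and eq: "proj x \<circ> s \<circ> inv' (proj x) = t"
  shows "quot (x \<otimes> transp_lift s \<otimes> inv x) = quot (transp_lift t)"
proof -
  obtain g where g: "g \<in> carrier G" "proj g \<circ> transpose 1 2 \<circ> inv' (proj g) = s"
    "transp_lift s = g \<otimes> t12 \<otimes> inv g" using s by (rule transp_lift_conj)
  obtain k where k: "k \<in> carrier G" "proj k \<circ> transpose 1 2 \<circ> inv' (proj k) = t"
    "transp_lift t = k \<otimes> t12 \<otimes> inv k" using t by (rule transp_lift_conj)
  have "bij (proj x)" "bij (proj g)" using x g proj_permutes permutes_bij by blast+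
  then have "proj (x \<otimes> g) \<circ> transpose 1 2 \<circ> inv' (proj (x \<otimes> g)) = t"
    using x g eq by (simp add: o_inv_distrib comp_assoc flip: g(2))
  then have "quot ((x \<otimes> g) \<otimes> t12 \<otimes> inv (x \<otimes> g)) = quot (k \<otimes> t12 \<otimes> inv k)"
    using x g k by (intro quot_conj_t12_eq) auto
  then show ?thesis using x g k t12 by (simp add: m_assoc inv_mult_group)
qed

lemma transposition_system_Quot:
  "transposition_system Quot d (\<lambda>t. quot (transp_lift t)) (quot (t12 \<otimes> t12))"
proof (intro transposition_system.intro group_Quot transposition_system_axioms.intro)
  fix t assume t: "t \<in> transps d"
  show "quot (transp_lift t) \<in> carrier Quot" using t by (simp add: quot_closed)
  obtain g where g: "g \<in> carrier G" "transp_lift t = g \<otimes> t12 \<otimes> inv g"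
    using t by (rule transp_lift_conj)
  have "transp_lift t \<otimes> transp_lift t = g \<otimes> (t12 \<otimes> t12) \<otimes> inv g"
    using g t12 by (simp add: m_assoc)
  also have "\<dots> = (t12 \<otimes> t12) \<otimes> g \<otimes> inv g"
    using g t12 by (subst kernel_central[of "t12 \<otimes> t12" g]) auto
  also have "\<dots> = t12 \<otimes> t12" using g t12 by (simp add: m_assoc)
  finally show "quot (transp_lift t) \<otimes>\<^bsub>Quot\<^esub> quot (transp_lift t) = quot (t12 \<otimes> t12)"
    using t by (simp flip: quot_mult)
next
  show "quot (t12 \<otimes> t12) \<in> carrier Quot" by (simp add: quot_closed t12)
next
  fix s t assume s: "s \<in> transps d" and t: "t \<in> transps d"
  have "inv' s = s" using s by (auto simp: transps_def)
  then have "quot (transp_lift s \<otimes> transp_lift t \<otimes> inv (transp_lift s)) = quot (transp_lift (s \<circ> t \<circ> s))"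
    using s t by (intro quot_conj_transp_lift conj_transps) (auto simp: proj_transp_lift)
  then have "quot (transp_lift (s \<circ> t \<circ> s)) \<otimes>\<^bsub>Quot\<^esub> quot (transp_lift s) =
      quot (transp_lift s \<otimes> transp_lift t \<otimes> inv (transp_lift s) \<otimes> transp_lift s)"
    using s t by (simp add: quot_mult)
  then show "quot (transp_lift s) \<otimes>\<^bsub>Quot\<^esub> quot (transp_lift t) =
      quot (transp_lift (s \<circ> t \<circ> s)) \<otimes>\<^bsub>Quot\<^esub> quot (transp_lift s)"
    using s t by (simp add: m_assoc quot_mult)
qed

interpretation Quot: transposition_system Quot d "\<lambda>t. quot (transp_lift t)" "quot (t12 \<otimes> t12)"
  by (rule transposition_system_Quot)

lemma ex_transp_word:
  assumes "p permutes {1..d}"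
  shows "\<exists>x\<in>carrier G. \<exists>w\<in>lists (transps d). proj x = p \<and> perm_of w = p \<and> quot x = Quot.T_of w"
proof -
  obtain w where w: "w \<in> lists (transps d)" "perm_of w = p"
    using ex_perm_of assms by blast
  have "\<exists>x\<in>carrier G. proj x = perm_of w \<and> quot x = Quot.T_of w"
    using w(1)
  proof (induction w)
    case Nil
    have "quot \<one> = \<one>\<^bsub>Quot\<^esub>" by (rule group_hom.hom_one[OF quot_hom])
    then show ?case by (intro bexI[of _ \<one>]) auto
  next
    case (Cons t w)
    then obtain y where "y \<in> carrier G" "proj y = perm_of w" "quot y = Quot.T_of w" by auto
    then show ?case using Cons
      by (intro bexI[of _ "transp_lift t \<otimes> y"]) (auto simp: quot_mult proj_transp_lift)
  qed
  then show ?thesis using w by auto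
qed

text \<open>
  The two entries of a commutator can be replaced by products of the lifts \<open>transp_lift\<close> over the
  same permutations, which does not change the commutator.
\<close>

lemma balanced_derived:
  assumes "x \<in> derived G (carrier G)"
  shows "Quot.balanced (quot x) (proj x)"
  using assms unfolding derived_def
proof (induction rule: generate.induct)
  have gen: "Quot.balanced (quot h) (proj h)" if h: "h \<in> derived_set G (carrier G)" for h
  proof -
    obtain x y where xy: "x \<in> carrier G" "y \<in> carrier G" "h = x \<otimes> y \<otimes> inv x \<otimes> inv y"
      using h by auto
    obtain x' v where x': "x' \<in> carrier G" "proj x' = proj x" and v: "v \<in> lists (transps d)"
      "perm_of v = proj x" "quot x' = Quot.T_of v"
      using ex_transp_word[OF proj_permutes[OF xy(1)]] by blast
    obtain y' w where y': "y' \<in> carrier G" "proj y' = proj y" and w: "w \<in> lists (transps d)"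
      "perm_of w = proj y" "quot y' = Quot.T_of w"
      using ex_transp_word[OF proj_permutes[OF xy(2)]] by blast
    have "h = x' \<otimes> y' \<otimes> inv x' \<otimes> inv y'"
      using comm_eq[OF xy(1,2)] comm_eq[OF x'(1) y'(1)] xy(3) x' y' by simp
    then have "quot h = Quot.T_of v \<otimes>\<^bsub>Quot\<^esub> Quot.T_of w \<otimes>\<^bsub>Quot\<^esub> inv\<^bsub>Quot\<^esub> Quot.T_of v \<otimes>\<^bsub>Quot\<^esub> inv\<^bsub>Quot\<^esub> Quot.T_of w"
      using x'(1) y'(1) v(3) w(3) by (simp add: quot_mult group_hom.hom_inv[OF quot_hom])
    moreover have "proj h = proj x \<circ> proj y \<circ> inv' (proj x) \<circ> inv' (proj y)"
      using xy by simp
    ultimately show ?thesis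
      using Quot.balanced_commutator[OF v(1) w(1)] v(2) w(2) by (simp only:)
  qed
  {
    case one
    have "quot \<one> = \<one>\<^bsub>Quot\<^esub>" by (rule group_hom.hom_one[OF quot_hom])
    then show ?case using Quot.balanced_one by (simp only: proj_one)
  next
    case (incl h)
    then show ?case by (rule gen)
  next
    case (inv h)
    then have "h \<in> carrier G" using derived_set_in_carrier by blast
    then show ?case
      using Quot.balanced_inv[OF gen[OF inv]] group_hom.hom_inv[OF quot_hom] by simp
  next
    case (eng h1 h2)
    then have "h1 \<in> carrier G" "h2 \<in> carrier G"
      using generate_in_carrier[OF derived_set_in_carrier[OF order_refl]] by blast+
    then show ?case using Quot.balanced_mult[OF eng.IH] by (simp only: quot_mult proj_mult)
  }
qed

theorem kernel_inter_derived: "kernel G (sym_group d) proj \<inter> derived G (carrier G) = {\<one>, c}"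
proof
  show "kernel G (sym_group d) proj \<inter> derived G (carrier G) \<subseteq> {\<one>, c}"
  proof
    fix x assume "x \<in> kernel G (sym_group d) proj \<inter> derived G (carrier G)"
    then have x: "x \<in> carrier G" "proj x = id" "x \<in> derived G (carrier G)"
      by (auto simp: kernel_def sym_group_def)
    then have "quot x = \<one>\<^bsub>Quot\<^esub>" using balanced_derived Quot.balanced_over_id by metis
    then show "x \<in> {\<one>, c}" using quot_eq_one_iff x by (simp add: c_group_def)
  qed
  have "lift (transpose 1 2) \<in> carrier G" "lift (transpose 3 4) \<in> carrier G"
    using four_le by (auto intro!: lift_closed permutes_swap_id)
  then have "c \<in> derived G (carrier G)"
    unfolding derived_def c_def comm_def by (intro generate.incl) blast
  moreover have "\<one> \<in> derived G (carrier G)"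
    unfolding derived_def by (rule generate.one)
  ultimately show "{\<one>, c} \<subseteq> kernel G (sym_group d) proj \<inter> derived G (carrier G)"
    by (auto simp: kernel_def sym_group_def)
qed

end

section \<open>Products of disjoint cycles\<close>

lemma evenperm_cycle_of_list:
  "\<lbrakk>distinct cs; cs \<noteq> []\<rbrakk> \<Longrightarrow> evenperm (cycle_of_list cs) \<longleftrightarrow> odd (length cs)"
proof (induction cs rule: cycle_of_list.induct)
  case (1 i j cs)
  have "evenperm (cycle_of_list (i # j # cs)) \<longleftrightarrow>
      evenperm (transpose i j) = evenperm (cycle_of_list (j # cs))"
    by (simp only: cycle_of_list.simps evenperm_comp permutation_swap_id permutation_of_cycle)
  then show ?case using 1 by (simp add: evenperm_swap del: cycle_of_list.simps)
qed auto

definition cycle_prod :: "nat list list \<Rightarrow> nat \<Rightarrow> nat" where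
  "cycle_prod cs = foldr (\<lambda>c q. cycle_of_list c \<circ> q) cs id"

lemma cycle_prod_simps [simp]:
  "cycle_prod [] = id" "cycle_prod (C # cs) = cycle_of_list C \<circ> cycle_prod cs"
  by (simp_all add: cycle_prod_def)

lemma cycle_prod_permutes: "cycle_prod cs permutes set (concat cs)"
proof (induction cs)
  case (Cons C cs)
  have "cycle_of_list C permutes set (concat (C # cs))"
    by (rule permutes_subset[OF cycle_permutes]) auto
  moreover have "cycle_prod cs permutes set (concat (C # cs))"
    by (rule permutes_subset[OF Cons.IH]) auto
  ultimately show ?case by (simp only: cycle_prod_simps permutes_compose)
qed (simp only: cycle_prod_simps permutes_id)

lemma cycle_prod_permute:
  assumes "distinct (concat cs)" "mset cs = mset cs'"
  shows "cycle_prod cs = cycle_prod cs'"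
proof -
  let ?f = "\<lambda>c (q :: nat \<Rightarrow> nat). cycle_of_list c \<circ> q"
  have "fold ?f (rev cs) = fold ?f (rev cs')"
  proof (rule fold_multiset_equiv)
    fix C D assume C: "C \<in> set (rev cs)" and D: "D \<in> set (rev cs)"
    have "cycle_of_list C \<circ> cycle_of_list D = cycle_of_list D \<circ> cycle_of_list C"
    proof (cases "C = D")
      case False
      with C D assms(1) show ?thesis
        by (intro cycles_commute) (auto simp: distinct_concat_iff)
    qed simp
    then show "?f C \<circ> ?f D = ?f D \<circ> ?f C" by (metis (no_types, lifting) comp_assoc comp_def ext)
  qed (use assms in simp)
  then show ?thesis by (simp only: cycle_prod_def foldr_conv_fold)
qed

lemma disjoint_cycles_alt:
  "disjoint_cycles d p cs \<longleftrightarrow>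
    [] \<notin> set cs \<and> distinct (concat cs) \<and> set (concat cs) = {1..d} \<and> p = cycle_prod cs"
  by (simp add: disjoint_cycles_def cycle_prod_def)

lemma disjoint_cycles_permute:
  assumes "disjoint_cycles d p cs" "mset cs = mset cs'"
  shows "disjoint_cycles d p cs'"
proof -
  have "set cs = set cs'" using assms(2) by (rule mset_eq_setD)
  moreover have "mset (concat cs) = mset (concat cs')"
    using assms(2) by (metis mset_concat mset_map sum_mset_sum_list)
  ultimately show ?thesis
    using assms cycle_prod_permute[of cs cs'] mset_eq_imp_distinct_iff[of "concat cs" "concat cs'"]
    by (auto simp: disjoint_cycles_alt)
qed

lemma ex_disjoint_cycles:
  assumes "p permutes {1..d}"
  shows "\<exists>cs. disjoint_cycles d p cs"
proof -
  have "\<exists>cs. [] \<notin> set cs \<and> distinct (concat cs) \<and> set (concat cs) = S \<and> p = cycle_prod cs"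
    if "cycle_decomp S p" for S and p :: "nat \<Rightarrow> nat"
    using that
  proof (induction rule: cycle_decomp.induct)
    case empty
    then show ?case by (intro exI[of _ "[]"]) simp
  next
    case (comp I p C)
    then obtain cs where cs: "[] \<notin> set cs" "distinct (concat cs)" "set (concat cs) = I"
      "p = cycle_prod cs" by blast
    show ?case
    proof (cases "C = []")
      case True
      then show ?thesis using cs by (intro exI[of _ cs]) auto
    next
      case False
      then show ?thesis using cs comp by (intro exI[of _ "C # cs"]) auto
    qed
  qed
  then show ?thesis using cycle_decomposition[OF assms] by (simp only: disjoint_cycles_alt) blast
qed

lemma ex_swapping_involution:
  assumes "length as = length bs" "distinct (as @ bs)"
  shows "\<exists>h. h permutes set as \<union> set bs \<and> map h as = bs \<and> map h bs = as \<and>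
    (evenperm h \<longleftrightarrow> even (length as))"
  using assms
proof (induction as bs rule: list_induct2)
  case Nil
  then show ?case by (intro exI[of _ id]) auto
next
  case (Cons a as b bs)
  then obtain h where h: "h permutes set as \<union> set bs" "map h as = bs" "map h bs = as"
    "evenperm h \<longleftrightarrow> even (length as)" by auto
  let ?h = "transpose a b \<circ> h"
  have perm: "?h permutes set (a # as) \<union> set (b # bs)"
    by (intro permutes_compose permutes_swap_id permutes_subset[OF h(1)]) auto
  have fix_ab: "h a = a" "h b = b"
    using Cons.prems by (auto intro!: permutes_not_in[OF h(1)])
  have "map (transpose a b) as = as" "map (transpose a b) bs = bs"
    using Cons.prems by (auto intro!: map_idI transpose_apply_other)
  then have "map ?h as = bs" "map ?h bs = as" by (simp_all only: map_map[symmetric] h(2,3))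
  moreover have "permutation h" by (rule permutes_imp_permutation[OF _ h(1)]) simp
  then have "evenperm ?h \<longleftrightarrow> even (length (a # as))"
    using Cons.prems h(4) by (simp add: evenperm_comp permutation_swap_id evenperm_swap)
  ultimately have "?h permutes set (a # as) \<union> set (b # bs) \<and> map ?h (a # as) = b # bs \<and>
      map ?h (b # bs) = a # as \<and> (evenperm ?h \<longleftrightarrow> even (length (a # as)))"
    using perm fix_ab by simp
  then show ?case by (rule exI[of _ ?h])
qed

lemma funpow_comp_commute:
  assumes "f \<circ> g = g \<circ> f"
  shows "f ^^ n \<circ> g = g \<circ> f ^^ n"
proof (induction n)
  case (Suc n)
  have "f ^^ Suc n \<circ> g = f \<circ> (f ^^ n \<circ> g)" by (simp add: comp_assoc)
  also have "\<dots> = (f \<circ> g) \<circ> f ^^ n" by (simp only: Suc comp_assoc)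
  finally show ?case by (simp only: assms funpow.simps comp_assoc)
qed simp

lemma funpow_of_comp:
  assumes "f \<circ> g = g \<circ> f"
  shows "(f \<circ> g) ^^ n = f ^^ n \<circ> g ^^ n"
proof (induction n)
  case (Suc n)
  have "(f \<circ> g) ^^ Suc n = f \<circ> (g \<circ> f ^^ n) \<circ> g ^^ n" by (simp only: funpow.simps Suc comp_assoc)
  also have "\<dots> = f \<circ> (f ^^ n \<circ> g) \<circ> g ^^ n" by (simp only: funpow_comp_commute[OF assms])
  finally show ?case by (simp only: funpow.simps comp_assoc)
qed simp

text \<open>
  The product of the lengths is an exponent that kills all the commuting factors.
\<close>

lemma cycle_prod_odd_order:
  assumes "distinct (concat cs)" "\<forall>C\<in>set cs. odd (length C)"
  shows "\<exists>m. odd m \<and> cycle_prod cs ^^ m = id"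
  using assms
proof (induction cs)
  case Nil
  then show ?case by (intro exI[of _ 1]) simp
next
  case (Cons C cs)
  have "distinct (concat cs)" "\<forall>C\<in>set cs. odd (length C)" using Cons.prems by auto
  then obtain m where m: "odd m" "cycle_prod cs ^^ m = id" using Cons.IH by blast
  let ?f = "cycle_of_list C" and ?g = "cycle_prod cs" and ?l = "length C"
  have commute: "?f \<circ> ?g = ?g \<circ> ?f"
    using Cons.prems
    by (intro disjoint_permutes_commute[OF cycle_permutes cycle_prod_permutes]) auto
  have "(?f \<circ> ?g) ^^ (?l * m) = ?f ^^ (?l * m) \<circ> ?g ^^ (m * ?l)"
    by (simp only: funpow_of_comp[OF commute] mult.commute[of m])
  also have "?f ^^ (?l * m) = id"
    using Cons.prems by (simp only: funpow_mult[symmetric] cycle_is_id_root distinct_append concat.simps id_funpow)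
  also have "?g ^^ (m * ?l) = id" by (simp only: funpow_mult[symmetric] m id_funpow)
  finally show ?case using m Cons.prems by (intro exI[of _ "?l * m"]) simp
qed

lemma cycle_of_list_funpow_nth:
  assumes "distinct C" "i < length C"
  shows "(cycle_of_list C ^^ n) (C ! i) = C ! ((i + n) mod length C)"
proof -
  have "map (cycle_of_list C ^^ n) C ! i = rotate n C ! i"
    by (simp only: cyclic_rotation[OF assms(1)])
  then show ?thesis using assms by (simp add: nth_rotate add.commute)
qed

lemma cycle_prod_funpow:
  assumes "distinct (concat cs)" "C \<in> set cs" "x \<in> set C"
  shows "(cycle_prod cs ^^ n) x = (cycle_of_list C ^^ n) x"
proof -
  obtain A B where "cs = A @ C # B" using assms(2) by (auto dest: split_list)
  then have m: "mset cs = mset (C # A @ B)" by simp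
  then have p: "cycle_prod cs = cycle_of_list C \<circ> cycle_prod (A @ B)"
    using cycle_prod_permute[OF assms(1) m] by simp
  have "set C \<inter> set (concat (A @ B)) = {}"
    using assms(1) \<open>cs = A @ C # B\<close> by auto
  then have "cycle_prod cs y = cycle_of_list C y" if "y \<in> set C" for y
  proof -
    have "cycle_prod (A @ B) y = y"
      using that \<open>set C \<inter> _ = {}\<close> by (intro permutes_not_in[OF cycle_prod_permutes]) auto
    then show ?thesis by (simp add: p)
  qed
  moreover have "(cycle_of_list C ^^ n) x \<in> set C" for n
    using permutes_in_image[OF permutes_funpow[OF cycle_permutes]] assms(3) by metis
  ultimately show ?thesis by (induction n) auto
qed

text \<open>
  The length of the cycle through a point can be read off from the powers that fix the point, so it
  is preserved by permutations that commute with the product.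
\<close>

lemma cycle_prod_funpow_fix_iff:
  assumes "distinct (concat cs)" "C \<in> set cs" "x \<in> set C"
  shows "(cycle_prod cs ^^ n) x = x \<longleftrightarrow> length C dvd n"
proof -
  have C: "distinct C" using assms(1,2) by (auto simp: distinct_concat_iff)
  obtain i where i: "i < length C" "x = C ! i" using assms(3) by (auto simp: in_set_conv_nth)
  have l: "(i + n) mod length C < length C" using i by (intro mod_less_divisor) auto
  have "(cycle_prod cs ^^ n) x = x \<longleftrightarrow> C ! ((i + n) mod length C) = C ! i"
    using cycle_prod_funpow[OF assms] cycle_of_list_funpow_nth[OF C i(1)] i(2) by simp
  also have "\<dots> \<longleftrightarrow> (i + n) mod length C = i mod length C"
    using C i l by (simp add: nth_eq_iff_index_eq)
  also have "\<dots> \<longleftrightarrow> length C dvd n"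
    by (metis add_diff_cancel_left' le_add1 mod_eq_dvd_iff_nat)
  finally show ?thesis .
qed

section \<open>Commutators with elements of the centralizer\<close>

context symmetric_central_extension
begin

lemma comm_mem:
  assumes "p permutes {1..d}" "q permutes {1..d}" "p \<circ> q = q \<circ> p"
  shows "comm p q \<in> {\<one>, c}"
proof -
  have "comm p q \<in> derived G (carrier G)"
    unfolding derived_def comm_def using lift_closed[OF assms(1)] lift_closed[OF assms(2)]
    by (intro generate.incl) blast
  then show ?thesis
    using assms proj_comm by (auto simp: kernel_inter_derived[symmetric] kernel_def sym_group_def)
qed

text \<open>
  Let \<open>x\<close> lift \<open>p\<close>, let \<open>y\<close> lift \<open>h\<close>, and lift \<open>p'\<close> by the conjugate \<open>x'\<close> of \<open>x\<close> by \<open>y\<close>.  The square of \<open>y\<close> is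
  central, so conjugation by \<open>y\<close> also carries \<open>x'\<close> back to \<open>x\<close>, and it turns \<open>x x'\<close> into \<open>x' x\<close>.
\<close>

lemma comm_involution_swapping:
  assumes p: "p permutes {1..d}" and h: "h permutes {1..d}"
    and hh: "h \<circ> h = id" and p': "h \<circ> p \<circ> inv' h = p'"
  shows "comm (p \<circ> p') h = comm p p'"
proof -
  let ?x = "lift p" and ?y = "lift h"
  define x' where "x' = ?y \<otimes> ?x \<otimes> inv ?y"
  have x: "?x \<in> carrier G" "?y \<in> carrier G" using p h by auto
  have x': "x' \<in> carrier G" "proj x' = p'" using x p h p' by (auto simp: x'_def)
  have p'_perm: "p' permutes {1..d}" using x' proj_permutes by blast
  have yx: "?y \<otimes> ?x = x' \<otimes> ?y" using x by (simp add: x'_def m_assoc)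
  have "?y \<otimes> x' = (?y \<otimes> ?y) \<otimes> ?x \<otimes> inv ?y" using x by (simp add: x'_def m_assoc)
  also have "\<dots> = ?x \<otimes> (?y \<otimes> ?y) \<otimes> inv ?y"
    using x h hh by (subst kernel_central) auto
  finally have yx': "?y \<otimes> x' = ?x \<otimes> ?y" using x by (simp add: m_assoc)
  show ?thesis
  proof (rule comm_eqI[of "?x \<otimes> x'" ?y])
    have "?x \<otimes> x' \<otimes> ?y = comm p p' \<otimes> (x' \<otimes> ?x) \<otimes> ?y"
      using comm_swap[OF x(1) x'(1)] p x' by simp
    also have "\<dots> = comm p p' \<otimes> (x' \<otimes> (?y \<otimes> x'))"
      using x x' p p'_perm by (simp add: yx' m_assoc)
    also have "x' \<otimes> (?y \<otimes> x') = ?y \<otimes> (?x \<otimes> x')"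
      using x x' by (simp add: m_assoc[symmetric] yx)
    finally show "?x \<otimes> x' \<otimes> ?y = comm p p' \<otimes> (?y \<otimes> (?x \<otimes> x'))" .
  qed (use x x' p p'_perm h in auto)
qed

lemma disjoint_cycles_Cons_facts:
  assumes "disjoint_cycles d p (C # cs)"
  shows "cycle_of_list C permutes set C" "cycle_prod cs permutes set (concat cs)"
    "set C \<inter> set (concat cs) = {}" "set C \<subseteq> {1..d}" "set (concat cs) \<subseteq> {1..d}"
    "distinct C" "C \<noteq> []" "p = cycle_of_list C \<circ> cycle_prod cs"
    "evenperm p \<longleftrightarrow> (odd (length C) \<longleftrightarrow> evenperm (cycle_prod cs))"
proof -
  show perm: "cycle_of_list C permutes set C" "cycle_prod cs permutes set (concat cs)"
    by (rule cycle_permutes, rule cycle_prod_permutes)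
  show *: "set C \<inter> set (concat cs) = {}" "set C \<subseteq> {1..d}" "set (concat cs) \<subseteq> {1..d}"
    "distinct C" "C \<noteq> []" "p = cycle_of_list C \<circ> cycle_prod cs"
    using assms by (auto simp: disjoint_cycles_alt)
  have "permutation (cycle_prod cs)"
    by (rule permutes_imp_permutation[OF _ perm(2)]) simp
  then show "evenperm p \<longleftrightarrow> (odd (length C) \<longleftrightarrow> evenperm (cycle_prod cs))"
    using * by (simp add: evenperm_comp permutation_of_cycle evenperm_cycle_of_list)
qed

lemma comm_cycle:
  assumes "disjoint_cycles d p (C # cs)"
  shows "p \<circ> cycle_of_list C = cycle_of_list C \<circ> p" (is ?commute)
    and "comm p (cycle_of_list C) = c_if (even (length C) \<and> \<not> evenperm (cycle_prod cs))"
proof -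
  note C = disjoint_cycles_Cons_facts[OF assms]
  let ?C = "cycle_of_list C" and ?q = "cycle_prod cs"
  have perm: "?C permutes {1..d}" "?q permutes {1..d}"
    using C(1-5) by (meson permutes_subset)+
  have comm: "?C \<circ> ?q = ?q \<circ> ?C" using C by (intro disjoint_permutes_commute)
  then show ?commute by (metis C(8) comp_assoc)
  have "comm p ?C = comm ?C ?C \<otimes> comm ?q ?C"
    unfolding C(8) using perm comm by (intro comm_mult_left) auto
  also have "\<dots> = comm ?q ?C" using perm by simp
  also have "\<dots> = c_if (\<not> evenperm ?q \<and> \<not> evenperm ?C)"
    using C(3) by (intro comm_disjoint[OF C(2,1) _ C(5,4)]) blast
  finally show "comm p ?C = c_if (even (length C) \<and> \<not> evenperm ?q)"
    using C by (simp add: evenperm_cycle_of_list conj_commute)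
qed

text \<open>
  The cycle is odd, and so is the product of the other cycles.
\<close>

lemma ex_comm_eq_c_even_cycle:
  assumes cs: "disjoint_cycles d p cs" and even: "evenperm p" and C: "C \<in> set cs" "even (length C)"
  shows "\<exists>h. h permutes {1..d} \<and> p \<circ> h = h \<circ> p \<and> comm p h = c"
proof -
  obtain A B where "cs = A @ C # B" using C(1) by (auto dest: split_list)
  then have cs': "disjoint_cycles d p (C # A @ B)"
    by (intro disjoint_cycles_permute[OF cs]) simp
  note facts = disjoint_cycles_Cons_facts[OF cs']
  have "comm p (cycle_of_list C) = c"
    using comm_cycle(2)[OF cs'] facts(9) even C(2) by (simp add: c_if_def)
  moreover have "cycle_of_list C permutes {1..d}" using facts(1,4) by (rule permutes_subset)
  ultimately show ?thesis using comm_cycle(1)[OF cs'] by blast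
qed

text \<open>
  The involution \<open>h\<close> swaps two cycles of length \<open>l\<close>.  Both cycles together contribute their own
  commutator, which is \<open>c\<close> if \<open>l\<close> is even.  The product of the remaining cycles is odd, and \<open>h\<close> is a
  product of \<open>l\<close> transpositions, so their commutator is \<open>c\<close> if \<open>l\<close> is odd.
\<close>

lemma ex_comm_eq_c_equal_cycles:
  assumes cs: "disjoint_cycles d p cs" and odd: "\<not> evenperm p"
    and eq: "\<not> distinct (map length cs)"
  shows "\<exists>h. h permutes {1..d} \<and> p \<circ> h = h \<circ> p \<and> comm p h = c"
proof -
  obtain xs ys zs l where "map length cs = xs @ [l] @ ys @ [l] @ zs"
    using not_distinct_decomp[OF eq] by blast
  then obtain A C B C' D where split: "cs = A @ C # B @ C' # D" "length C = l" "length C' = l"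
    by (auto simp: map_eq_append_conv append_eq_map_conv map_eq_Cons_conv Cons_eq_map_conv)
  define rest where "rest = A @ B @ D"
  have cs': "disjoint_cycles d p (C # C' # rest)"
    by (intro disjoint_cycles_permute[OF cs]) (simp add: split rest_def)
  have dist: "distinct (C @ C' @ concat rest)" "set (C @ C' @ concat rest) = {1..d}" "C \<noteq> []" "C' \<noteq> []"
    "p = cycle_of_list C \<circ> (cycle_of_list C' \<circ> cycle_prod rest)"
    using cs' by (auto simp: disjoint_cycles_alt)
  let ?C = "cycle_of_list C" and ?C' = "cycle_of_list C'" and ?q = "cycle_prod rest"
  have evenC: "evenperm ?C \<longleftrightarrow> odd l" "evenperm ?C' \<longleftrightarrow> odd l"
    using dist split by (simp_all add: evenperm_cycle_of_list)
  have sub: "set C \<subseteq> {1..d}" "set C' \<subseteq> {1..d}" "set C \<union> set C' \<subseteq> {1..d}" "set (concat rest) \<subseteq> {1..d}"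
    using dist(2) by auto
  have qperm: "?q permutes set (concat rest)" by (rule cycle_prod_permutes)
  have perm: "?C permutes {1..d}" "?C' permutes {1..d}" "?q permutes {1..d}"
    using sub cycle_permutes qperm by (meson permutes_subset)+
  have p_eq: "p = (?C \<circ> ?C') \<circ> ?q" by (simp only: dist(5) comp_assoc)
  have "permutation ?q" by (rule permutes_imp_permutation[OF _ perm(3)]) simp
  then have q_odd: "\<not> evenperm ?q"
    using odd unfolding p_eq
    by (simp only: evenperm_comp permutation_compose permutation_of_cycle evenC) blast
  obtain h where h: "h permutes set C \<union> set C'" "map h C = C'" "map h C' = C"
    "evenperm h \<longleftrightarrow> even l"
    using ex_swapping_involution[of C C'] dist(1) split by auto
  have h_perm: "h permutes {1..d}" using h(1) sub(3) by (rule permutes_subset)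
  have hh: "h \<circ> h = id"
  proof
    fix x
    show "(h \<circ> h) x = id x"
    proof (cases "x \<in> set C \<union> set C'")
      case True
      have "map (h \<circ> h) C = C" "map (h \<circ> h) C' = C'" by (simp_all only: map_map[symmetric] h)
      then show ?thesis using True by (auto simp: map_eq_conv list_eq_iff_nth_eq in_set_conv_nth)
    next
      case False
      then show ?thesis using permutes_not_in[OF h(1)] by simp
    qed
  qed
  have bij: "bij h" using h_perm permutes_bij by blast
  have hC: "h \<circ> ?C \<circ> inv' h = ?C'" "h \<circ> ?C' \<circ> inv' h = ?C"
    using conjugation_of_cycle[OF _ bij] dist(1) h(2,3) by auto
  have inv_h: "inv' h \<circ> h = id" using h_perm permutes_inv_o(2) by blast
  have hC1: "h \<circ> ?C = ?C' \<circ> h"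
    unfolding hC(1)[symmetric] by (simp only: comp_assoc inv_h comp_id)
  have hC2: "h \<circ> ?C' = ?C \<circ> h"
    unfolding hC(2)[symmetric] by (simp only: comp_assoc inv_h comp_id)
  have hCC: "(?C \<circ> ?C') \<circ> h = h \<circ> (?C \<circ> ?C')"
  proof -
    have "?C \<circ> ?C' = ?C' \<circ> ?C" using dist(1) by (intro cycles_commute) auto
    then have "(?C \<circ> ?C') \<circ> h = ?C' \<circ> (?C \<circ> h)" by (simp only: comp_assoc)
    also have "\<dots> = (?C' \<circ> h) \<circ> ?C'"
      by (simp only: hC2[symmetric]) (simp only: comp_assoc)
    also have "\<dots> = h \<circ> (?C \<circ> ?C')"
      by (simp only: hC1[symmetric]) (simp only: comp_assoc)
    finally show ?thesis .
  qed
  have disj: "set (concat rest) \<inter> (set C \<union> set C') = {}" using dist(1) by auto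
  have hq: "?q \<circ> h = h \<circ> ?q" using qperm h(1) disj by (rule disjoint_permutes_commute)
  have "comm p h = comm (?C \<circ> ?C') h \<otimes> comm ?q h"
    unfolding p_eq using perm h_perm hCC hq by (intro comm_mult_left permutes_compose)
  also have "comm (?C \<circ> ?C') h = comm ?C ?C'"
    by (rule comm_involution_swapping[OF perm(1) h_perm hh hC(1)])
  also have "\<dots> = c_if (even l)"
    using dist(1) sub by (subst comm_disjoint[OF cycle_permutes cycle_permutes]) (auto simp: evenC)
  also have "comm ?q h = c_if (odd l)"
    using comm_disjoint[OF qperm h(1) disj sub(4,3)] by (simp add: q_odd h(4))
  also have "c_if (even l) \<otimes> c_if (odd l) = c" by (simp add: c_if_def)
  finally have "comm p h = c" .
  moreover have "p \<circ> h = h \<circ> p" 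
  proof -
    have "p \<circ> h = (?C \<circ> ?C') \<circ> (h \<circ> ?q)" by (simp only: p_eq hq comp_assoc)
    also have "\<dots> = ((?C \<circ> ?C') \<circ> h) \<circ> ?q" by (simp only: comp_assoc)
    also have "\<dots> = h \<circ> p" by (simp only: hCC p_eq) (simp only: comp_assoc)
    finally show ?thesis .
  qed
  ultimately show ?thesis using h_perm by blast
qed

text \<open>
  Since \<open>p\<close> has odd order, it is the square of one of its powers \<open>r\<close>, which again commutes with \<open>h\<close>.
  The commutator of lifts of \<open>p\<close> and \<open>h\<close> is then the square of \<open>1\<close> or \<open>c\<close>.
\<close>

lemma comm_eq_one_odd_cycles:
  assumes cs: "disjoint_cycles d p cs" and odd: "\<forall>C\<in>set cs. odd (length C)"
    and h: "h permutes {1..d}" "p \<circ> h = h \<circ> p"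
  shows "comm p h = \<one>"
proof -
  obtain m where m: "odd m" "p ^^ m = id"
    using cycle_prod_odd_order[of cs] cs odd by (auto simp: disjoint_cycles_alt)
  define r where "r = p ^^ ((m + 1) div 2)"
  have p: "p permutes {1..d}"
    using cs cycle_prod_permutes[of cs] by (simp add: disjoint_cycles_alt)
  have r: "r permutes {1..d}" unfolding r_def by (rule permutes_funpow[OF p])
  have "r \<circ> r = p ^^ (m + 1)"
  proof -
    have "(m + 1) div 2 + (m + 1) div 2 = m + 1" using m(1) by presburger
    then show ?thesis by (simp only: r_def funpow_add[symmetric])
  qed
  then have rr: "r \<circ> r = p" using m(2) by (simp add: funpow_add)
  have rh: "r \<circ> h = h \<circ> r" unfolding r_def by (rule funpow_comp_commute[OF h(2)])
  have "comm p h = comm r h \<otimes> comm r h"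
    using comm_mult_left[OF r r h(1) rh rh] rr by simp
  then show ?thesis using comm_mem[OF r h(1) rh] by auto
qed

text \<open>
  The centralizer of \<open>p\<close> is generated by the cycles of \<open>p\<close>.  A cycle of odd length is even; if a cycle
  is odd, the product of the other cycles is even because \<open>p\<close> is odd.  In both cases the lifts of the
  cycle commute with those of \<open>p\<close>.
\<close>

lemma comm_eq_one_distinct_cycles:
  assumes cs: "disjoint_cycles d p cs" and odd: "\<not> evenperm p" and dist: "distinct (map length cs)"
    and h: "h permutes {1..d}" "p \<circ> h = h \<circ> p"
  shows "comm h p = \<one>"
proof -
  have cs': "distinct (concat cs)" "set (concat cs) = {1..d}" "[] \<notin> set cs" and p_eq: "p = cycle_prod cs"
    using cs by (auto simp: disjoint_cycles_alt)
  have p: "p permutes {1..d}" using cycle_prod_permutes[of cs] cs'(2) by (simp add: p_eq)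
  \<comment> \<open>A permutation that commutes with \<open>p\<close> maps each cycle to a cycle of the same length, hence to itself,
    and on the cycle it is determined by the image of one point.\<close>
  have power: "\<exists>k. \<forall>x\<in>set C. h x = (cycle_of_list C ^^ k) x"
    if C: "C \<in> set cs" and h: "h permutes {1..d}" "p \<circ> h = h \<circ> p" for C h
  proof -
    have dC: "distinct C" "C \<noteq> []" using C cs' by (auto simp: distinct_concat_iff)
    have hp: "h ((p ^^ n) x) = (p ^^ n) (h x)" for n x
      using funpow_comp_commute[OF h(2), of n] by (metis comp_apply)
    let ?x = "C ! 0"
    have x: "?x \<in> set C" using dC by simp
    then have "?x \<in> set (concat cs)" using C by auto
    then have "h ?x \<in> set (concat cs)"
      unfolding cs'(2) using permutes_in_image[OF h(1)] by blast
    then obtain C' where C': "C' \<in> set cs" "h ?x \<in> set C'" by auto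
    have "length C dvd n \<longleftrightarrow> length C' dvd n" for n
    proof -
      have "(p ^^ n) ?x = ?x \<longleftrightarrow> h ((p ^^ n) ?x) = h ?x"
        using permutes_inj[OF h(1)] by (simp add: inj_eq)
      then show ?thesis
        using cycle_prod_funpow_fix_iff[OF cs'(1) C x] cycle_prod_funpow_fix_iff[OF cs'(1) C']
        by (simp add: hp p_eq[symmetric])
    qed
    then have "length C = length C'" by (meson dvd_antisym dvd_refl)
    then have "C' = C" using dist C C' by (auto simp: distinct_map dest: inj_onD)
    then obtain k where k: "k < length C" "h ?x = C ! k" using C' by (auto simp: in_set_conv_nth)
    have "h y = (cycle_of_list C ^^ k) y" if y: "y \<in> set C" for y
    proof -
      obtain i where i: "i < length C" "y = C ! i" using y by (auto simp: in_set_conv_nth)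
      have pow: "(p ^^ n) (C ! j) = C ! ((j + n) mod length C)" if "j < length C" for n j
        using that cycle_prod_funpow[OF cs'(1) C, of "C ! j" n] cycle_of_list_funpow_nth[OF dC(1)]
        by (simp add: p_eq)
      have "h y = h ((p ^^ i) ?x)" using i pow[of 0 i] dC by simp
      also have "\<dots> = C ! ((k + i) mod length C)" using k by (simp add: hp pow)
      also have "\<dots> = (cycle_of_list C ^^ k) y"
        using i cycle_of_list_funpow_nth[OF dC(1)] by (simp add: add.commute)
      finally show ?thesis .
    qed
    then show ?thesis by blast
  qed
  have "comm h p = \<one>" if "set D \<subseteq> set cs" "h permutes set (concat D)" "p \<circ> h = h \<circ> p" for D h
    using that
  proof (induction D arbitrary: h)
    case Nil
    then have "h = id" by simp
    then show ?case using p by (simp only: comm_id_left)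
  next
    case (Cons C D)
    have C: "C \<in> set cs" using Cons.prems by simp
    have hp: "h permutes {1..d}" using Cons.prems(1) cs'(2)
      by (intro permutes_subset[OF Cons.prems(2)]) auto
    obtain k where k: "\<And>x. x \<in> set C \<Longrightarrow> h x = (cycle_of_list C ^^ k) x"
      using power[OF C hp Cons.prems(3)] by blast
    define f where "f = cycle_of_list C"
    obtain A B where "cs = A @ C # B" using C by (auto dest: split_list)
    then have front: "disjoint_cycles d p (C # A @ B)"
      by (intro disjoint_cycles_permute[OF cs]) simp
    note facts = disjoint_cycles_Cons_facts[OF front]
    have f: "f permutes {1..d}" unfolding f_def using facts(1,4) by (rule permutes_subset)
    have fp: "f \<circ> p = p \<circ> f" unfolding f_def by (rule comm_cycle(1)[OF front, symmetric])
    have "comm p f = c_if False"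
      using comm_cycle(2)[OF front] facts(9) odd unfolding f_def by auto
    then have comm_f: "comm f p = \<one>" using comm_commute[OF p f, of False] by (simp add: c_if_def)
    have comm_fn: "comm (f ^^ n) p = \<one>" for n
    proof (induction n)
      case 0
      show ?case using p by (simp only: funpow.simps comm_id_left)
    next
      case (Suc n)
      have "comm (f \<circ> f ^^ n) p = comm f p \<otimes> comm (f ^^ n) p"
        using f p fp by (intro comm_mult_left permutes_funpow funpow_comp_commute)
      then show ?case by (simp only: funpow.simps Suc comm_f l_one one_closed)
    qed
    \<comment> \<open>Dividing \<open>h\<close> by this power of the cycle leaves a permutation supported on the other cycles.\<close>
    define g where "g = f ^^ k"
    define h' where "h' = inv' g \<circ> h"
    have g: "g permutes {1..d}" "g \<circ> p = p \<circ> g" "g permutes set C"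
      unfolding g_def using f fp facts(1)
      by (auto intro!: permutes_funpow funpow_comp_commute simp: f_def)
    have g_inv: "inv' g \<circ> g = id" "g \<circ> inv' g = id" using g(1) permutes_inv_o by blast+
    have h_eq: "h = g \<circ> h'" by (simp only: h'_def comp_assoc[symmetric] g_inv id_comp)
    have h'p: "p \<circ> h' = h' \<circ> p"
    proof -
      have "g \<circ> (p \<circ> h') = g \<circ> (h' \<circ> p)"
        using g(2) Cons.prems(3) h_eq by (metis comp_assoc)
      then show ?thesis using g_inv by (metis comp_assoc id_comp)
    qed
    have "h' permutes set (concat D)"
    proof (rule permutes_superset)
      have "inv' g permutes set (concat (C # D))"
        by (rule permutes_subset[OF permutes_inv[OF g(3)]]) simp
      then show "h' permutes set (concat (C # D))"
        unfolding h'_def by (rule permutes_compose[OF Cons.prems(2)])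
    next
      fix x assume "x \<in> set (concat (C # D)) - set (concat D)"
      then have "x \<in> set C" by auto
      then have "h x = g x" using k by (simp only: g_def f_def)
      then show "h' x = x" using g_inv(1) by (metis comp_apply h'_def id_apply)
    qed
    then have "comm h' p = \<one>" using Cons.prems(1) by (intro Cons.IH h'p) auto
    moreover have "h' permutes {1..d}"
      unfolding h'_def using g hp permutes_inv permutes_compose by blast
    then have "comm h p = comm g p \<otimes> comm h' p"
      unfolding h_eq using g p h'p by (intro comm_mult_left) auto
    ultimately show ?case using comm_fn by (simp add: g_def)
  qed
  from this[of cs h] show ?thesis using h cs'(2) by simp
qed

end

section \<open>An extension in which disjoint transpositions do not lift to commuting elements\<close>

type_synonym spinor = "nat set \<Rightarrow> real"

text \<open>
  The Jordan-Wigner sign.  Only finitely many elements of \<open>S\<close> lie below \<open>i\<close>, so \<open>S\<close> may be infinite.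
\<close>

definition jw_sign :: "nat \<Rightarrow> nat set \<Rightarrow> real" where
  "jw_sign i S = (- 1) ^ card {s \<in> S. s < i}"

text \<open>
  Generators of a Clifford algebra, represented by linear operators: \<open>gamma i\<close> toggles the membership
  of \<open>i\<close> in a set.  Working with operators gives associativity for free.
\<close>

definition gamma :: "nat \<Rightarrow> spinor \<Rightarrow> spinor" where
  "gamma i f = (\<lambda>S. jw_sign i S * f (sym_diff S {i}))"

lemma jw_sign_toggle_ge:
  assumes "i \<le> j"
  shows "jw_sign i (sym_diff S {j}) = jw_sign i S"
proof -
  have "{s \<in> sym_diff S {j}. s < i} = {s \<in> S. s < i}" using assms by auto
  then show ?thesis by (simp add: jw_sign_def)
qed

lemma jw_sign_toggle_less:
  assumes "i < j"
  shows "jw_sign j (sym_diff S {i}) = - jw_sign j S"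
proof (cases "i \<in> S")
  case True
  have "{s \<in> S. s < j} = insert i {s \<in> sym_diff S {i}. s < j}" using assms True by auto
  moreover have "i \<notin> {s \<in> sym_diff S {i}. s < j}" using True by auto
  ultimately show ?thesis by (simp add: jw_sign_def)
next
  case False
  have "{s \<in> sym_diff S {i}. s < j} = insert i {s \<in> S. s < j}" using assms False by auto
  moreover have "i \<notin> {s \<in> S. s < j}" using False by auto
  ultimately show ?thesis by (simp add: jw_sign_def)
qed

lemma jw_sign_square: "jw_sign i S * jw_sign i S = 1"
  by (simp add: jw_sign_def flip: power_add mult_2)

lemma gamma_square: "gamma i (gamma i f) = f"
proof
  fix S
  have "gamma i (gamma i f) S = (jw_sign i S * jw_sign i S) * f (sym_diff (sym_diff S {i}) {i})"
    by (simp only: gamma_def jw_sign_toggle_ge[OF order_refl] mult.assoc)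
  moreover have "sym_diff (sym_diff S {i}) {i} = S" by auto
  ultimately show "gamma i (gamma i f) S = f S" by (simp only: jw_sign_square mult_1)
qed

lemma gamma_anticommute:
  assumes "i \<noteq> j"
  shows "gamma i (gamma j f) S = - gamma j (gamma i f) S"
proof -
  have main: "gamma i (gamma j f) S = - gamma j (gamma i f) S" if "i < j" for i j
  proof -
    have "sym_diff (sym_diff S {i}) {j} = sym_diff (sym_diff S {j}) {i}" by auto
    then show ?thesis
      using that jw_sign_toggle_less[OF that, of S] jw_sign_toggle_ge[of i j S]
      by (simp add: gamma_def)
  qed
  show ?thesis using main[of i j] main[of j i] assms by (cases "i < j") auto
qed

definition linear_op :: "(spinor \<Rightarrow> spinor) \<Rightarrow> bool" where
  "linear_op A \<longleftrightarrow> (\<forall>x y f g. A (\<lambda>S. x * f S + y * g S) = (\<lambda>S. x * A f S + y * A g S))"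

lemma linear_op_gamma: "linear_op (gamma i)"
  by (simp add: linear_op_def gamma_def algebra_simps)

lemma linear_op_comp: "linear_op A \<Longrightarrow> linear_op B \<Longrightarrow> linear_op (A \<circ> B)"
  by (simp add: linear_op_def)

text \<open>
  The operator of the unit vector \<open>(e\<^sub>i - e\<^sub>j) / \<surd>2\<close>.  Up to sign, conjugation by it is the reflection
  that exchanges the coordinates \<open>i\<close> and \<open>j\<close>.
\<close>

definition pin :: "nat \<Rightarrow> nat \<Rightarrow> spinor \<Rightarrow> spinor" where
  "pin i j f = (\<lambda>S. (1 / sqrt 2) * gamma i f S + (- 1 / sqrt 2) * gamma j f S)"

lemma linear_opD: "linear_op A \<Longrightarrow> A (\<lambda>S. x * f S + y * g S) = (\<lambda>S. x * A f S + y * A g S)"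
  by (simp add: linear_op_def)

lemma linear_op_pin: "linear_op (pin i j)"
  unfolding linear_op_def pin_def
  by (simp add: linear_opD[OF linear_op_gamma] algebra_simps)

lemma pin_square:
  assumes "i \<noteq> j"
  shows "pin i j (pin i j f) = f"
proof
  fix S
  have h: "1 / sqrt 2 * (1 / sqrt 2) = (1 / 2 :: real)" by simp
  have "pin i j (pin i j f) S =
      (1 / sqrt 2 * (1 / sqrt 2)) * (gamma i (gamma i f) S + gamma j (gamma j f) S
        - (gamma i (gamma j f) S + gamma j (gamma i f) S))"
    unfolding pin_def linear_opD[OF linear_op_gamma] by (simp add: algebra_simps)
  then show "pin i j (pin i j f) S = f S"
    unfolding h using gamma_anticommute[OF assms, of f S] by (simp add: gamma_square)
qed

lemma pin_gamma:
  assumes "i \<noteq> j"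
  shows "pin i j (gamma k f) S = - gamma (transpose i j k) (pin i j f) S"
proof -
  have "gamma (transpose i j k) (pin i j f) S =
      1 / sqrt 2 * gamma (transpose i j k) (gamma i f) S
        + (- 1 / sqrt 2) * gamma (transpose i j k) (gamma j f) S"
    unfolding pin_def linear_opD[OF linear_op_gamma] ..
  then show ?thesis
    using assms gamma_anticommute[of i k f S] gamma_anticommute[of j k f S]
      gamma_anticommute[of i j f S]
    by (cases "k = i"; cases "k = j")
      (auto simp: pin_def gamma_square)
qed

lemma pin_pin:
  assumes "i \<noteq> j"
  shows "pin i j (pin k l f) S = - pin (transpose i j k) (transpose i j l) (pin i j f) S"
  unfolding pin_def[of k l] linear_opD[OF linear_op_pin]
  by (simp add: pin_gamma[OF assms] pin_def[of "transpose i j k"])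

definition pairs_on :: "nat \<Rightarrow> (nat \<times> nat) set" where
  "pairs_on d = {(i, j). i \<in> {1..d} \<and> j \<in> {1..d} \<and> i \<noteq> j}"

text \<open>
  The permutation is recorded next to the operator, so that the projection to the symmetric group is
  a homomorphism by construction.
\<close>

definition pair_word :: "(nat \<times> nat) list \<Rightarrow> (nat \<Rightarrow> nat) \<times> (spinor \<Rightarrow> spinor)" where
  "pair_word w = (foldr (\<lambda>(i, j) p. transpose i j \<circ> p) w id, foldr (\<lambda>(i, j) A. pin i j \<circ> A) w id)"

lemma pair_word_Nil [simp]: "pair_word [] = (id, id)"
  by (simp add: pair_word_def)

lemma pair_word_Cons:
  "pair_word ((i, j) # w) = (transpose i j \<circ> fst (pair_word w), pin i j \<circ> snd (pair_word w))"
  by (simp add: pair_word_def)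

lemma pair_word_append:
  "pair_word (v @ w) = (fst (pair_word v) \<circ> fst (pair_word w), snd (pair_word v) \<circ> snd (pair_word w))"
proof (induction v)
  case (Cons x v)
  show ?case
    by (cases x) (simp only: append_Cons pair_word_Cons Cons fst_conv snd_conv comp_assoc)
qed (simp only: append_Nil pair_word_Nil fst_conv snd_conv id_comp prod.collapse)

definition spin_group :: "nat \<Rightarrow> ((nat \<Rightarrow> nat) \<times> (spinor \<Rightarrow> spinor)) monoid" where
  "spin_group d = \<lparr> carrier = pair_word ` lists (pairs_on d),
     mult = (\<lambda>x y. (fst x \<circ> fst y, snd x \<circ> snd y)), one = (id, id) \<rparr>"

lemma pair_word_rev:
  "w \<in> lists (pairs_on d) \<Longrightarrow> pair_word (rev w @ w) = (id, id)"
proof (induction w)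
  case (Cons x w)
  obtain i j where x: "x = (i, j)" by (cases x)
  have ij: "i \<noteq> j" using Cons.prems by (auto simp: x pairs_on_def)
  have sq: "pair_word [(i, j), (i, j)] = (id, id)"
    using ij by (auto simp: pair_word_Cons fun_eq_iff pin_square)
  have "pair_word (rev (x # w) @ x # w) = pair_word (rev w @ [(i, j), (i, j)] @ w)" by (simp add: x)
  also have "\<dots> = pair_word (rev w @ w)"
    by (simp only: pair_word_append sq fst_conv snd_conv id_comp)
  finally show ?case using Cons by simp
qed simp

lemma group_spin_group: "group (spin_group d)"
proof (rule groupI)
  fix x y z
  assume x: "x \<in> carrier (spin_group d)" and y: "y \<in> carrier (spin_group d)"
  obtain v w where v: "v \<in> lists (pairs_on d)" "x = pair_word v"
    and w: "w \<in> lists (pairs_on d)" "y = pair_word w"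
    using x y by (auto simp: spin_group_def)
  then have "x \<otimes>\<^bsub>spin_group d\<^esub> y = pair_word (v @ w)" "v @ w \<in> lists (pairs_on d)"
    by (simp_all add: spin_group_def pair_word_append)
  then show "x \<otimes>\<^bsub>spin_group d\<^esub> y \<in> carrier (spin_group d)" by (auto simp: spin_group_def)
next
  fix x assume "x \<in> carrier (spin_group d)"
  then obtain w where w: "w \<in> lists (pairs_on d)" "x = pair_word w"
    by (auto simp: spin_group_def)
  then have "pair_word (rev w) \<otimes>\<^bsub>spin_group d\<^esub> x = \<one>\<^bsub>spin_group d\<^esub>" "rev w \<in> lists (pairs_on d)"
    using pair_word_rev[OF w(1)] by (simp_all add: spin_group_def pair_word_append)
  then show "\<exists>y\<in>carrier (spin_group d). y \<otimes>\<^bsub>spin_group d\<^esub> x = \<one>\<^bsub>spin_group d\<^esub>"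
    by (intro bexI[of _ "pair_word (rev w)"]) (auto simp: spin_group_def)
qed (auto simp: spin_group_def comp_assoc intro!: image_eqI[of _ _ "[]"])

lemma linear_op_pair_word: "linear_op (snd (pair_word w))"
proof (induction w)
  case Nil
  show ?case by (simp add: linear_op_def)
next
  case (Cons x w)
  then show ?case
    by (cases x) (simp only: pair_word_Cons snd_conv linear_op_comp linear_op_pin)
qed

lemma pair_word_permutes:
  "w \<in> lists (pairs_on d) \<Longrightarrow> fst (pair_word w) permutes {1..d}"
proof (induction w)
  case Nil
  show ?case by (simp only: pair_word_Nil fst_conv permutes_id)
next
  case (Cons x w)
  obtain i j where x: "x = (i, j)" by (cases x)
  have "(i, j) \<in> pairs_on d" "w \<in> lists (pairs_on d)" using Cons.prems by (auto simp: x)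
  then have ij: "i \<in> {1..d}" "j \<in> {1..d}" and w: "fst (pair_word w) permutes {1..d}"
    using Cons.IH by (simp_all only: pairs_on_def mem_Collect_eq prod.case)
  show ?case
    using permutes_compose[OF w permutes_swap_id[OF ij]]
    by (simp only: x pair_word_Cons fst_conv)
qed

text \<open>
  Every generator contributes a sign, and a word for \<open>p\<close> has the parity of \<open>p\<close>.
\<close>

lemma pair_word_gamma:
  "w \<in> lists (pairs_on d) \<Longrightarrow> snd (pair_word w) (gamma k f) =
    (\<lambda>S. (if evenperm (fst (pair_word w)) then 1 else - 1) *
      gamma (fst (pair_word w) k) (snd (pair_word w) f) S)"
proof (induction w)
  case Nil
  show ?case by simp
next
  case (Cons x w)
  obtain i j where x: "x = (i, j)" by (cases x)
  let ?p = "fst (pair_word w)" and ?A = "snd (pair_word w)"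
  have "(i, j) \<in> pairs_on d" and w: "w \<in> lists (pairs_on d)"
    using Cons.prems by (auto simp: x)
  then have ij: "i \<noteq> j" by (simp add: pairs_on_def)
  let ?e = "if evenperm ?p then 1 else - 1 :: real"
  have "permutation ?p" by (rule permutes_imp_permutation[OF _ pair_word_permutes[OF w]]) simp
  then have even: "evenperm (transpose i j \<circ> ?p) \<longleftrightarrow> \<not> evenperm ?p"
    using ij by (simp only: evenperm_comp permutation_swap_id evenperm_swap) simp
  have "pin i j (?A (gamma k f)) = pin i j (\<lambda>S. ?e * gamma (?p k) (?A f) S + 0 * f S)"
    by (simp only: Cons.IH[OF w]) simp
  also have "\<dots> = (\<lambda>S. ?e * pin i j (gamma (?p k) (?A f)) S)"
    by (simp only: linear_opD[OF linear_op_pin]) simp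
  also have "\<dots> = (\<lambda>S. - ?e * gamma (transpose i j (?p k)) (pin i j (?A f)) S)"
    by (simp only: pin_gamma[OF ij]) simp
  also have "- ?e = (if evenperm (fst (pair_word (x # w))) then 1 else - 1)"
    by (simp only: x pair_word_Cons fst_conv even) simp
  also have "transpose i j (?p k) = fst (pair_word (x # w)) k" by (simp add: x pair_word_Cons)
  finally show ?case by (simp add: x pair_word_Cons)
qed

text \<open>
  An operator over the identity commutes with all \<open>gamma k\<close>, hence with all generators of the group.
\<close>

lemma pair_word_kernel_central:
  assumes w: "w \<in> lists (pairs_on d)" and id: "fst (pair_word w) = id" and v: "v \<in> lists (pairs_on d)"
  shows "snd (pair_word w) \<circ> snd (pair_word v) = snd (pair_word v) \<circ> snd (pair_word w)"
  using v
proof (induction v)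
  case (Cons x v)
  obtain i j where x: "x = (i, j)" by (cases x)
  let ?A = "snd (pair_word w)"
  have "?A (gamma k f) = gamma k (?A f)" for k f
    by (simp only: pair_word_gamma[OF w] id evenperm_id) simp
  then have "?A (pin i j f) = pin i j (?A f)" for f
    unfolding pin_def by (simp only: linear_opD[OF linear_op_pair_word])
  then have pin: "?A \<circ> pin i j = pin i j \<circ> ?A" by (simp add: fun_eq_iff)
  have IH: "?A \<circ> snd (pair_word v) = snd (pair_word v) \<circ> ?A"
    by (rule Cons.IH)
  have "?A \<circ> snd (pair_word (x # v)) = (?A \<circ> pin i j) \<circ> snd (pair_word v)"
    by (simp only: x pair_word_Cons snd_conv comp_assoc)
  also have "\<dots> = pin i j \<circ> (?A \<circ> snd (pair_word v))" by (simp only: pin comp_assoc)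
  also have "\<dots> = snd (pair_word (x # v)) \<circ> ?A"
    by (simp only: IH x pair_word_Cons snd_conv comp_assoc)
  finally show ?case .
qed simp

lemma spin_extension:
  assumes "4 \<le> d"
  shows "symmetric_central_extension (spin_group d) d fst"
proof (intro symmetric_central_extension.intro symmetric_central_extension_axioms.intro group_spin_group assms)
  show "fst \<in> hom (spin_group d) (sym_group d)"
  proof (rule homI)
    fix x assume "x \<in> carrier (spin_group d)"
    then show "fst x \<in> carrier (sym_group d)"
      unfolding sym_group_carrier using pair_word_permutes by (auto simp: spin_group_def simp del: One_nat_def)
  qed (simp add: spin_group_def sym_group_def)
next
  fix p assume "p permutes {1..d}"
  then have "\<exists>w\<in>lists (pairs_on d). fst (pair_word w) = p"
    using finite_atLeastAtMost
  proof (induction p rule: permutes_induct)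
    case id
    then show ?case by (intro bexI[of _ "[]"]) auto
  next
    case (swap a b p)
    then obtain w where "w \<in> lists (pairs_on d)" "fst (pair_word w) = p" by blast
    then show ?case
      using swap by (intro bexI[of _ "(a, b) # w"]) (auto simp: pair_word_Cons pairs_on_def)
  qed
  then show "\<exists>x\<in>carrier (spin_group d). fst x = p" by (auto simp: spin_group_def)
next
  fix x y assume "x \<in> carrier (spin_group d)" "fst x = id" "y \<in> carrier (spin_group d)"
  then show "x \<otimes>\<^bsub>spin_group d\<^esub> y = y \<otimes>\<^bsub>spin_group d\<^esub> x"
    using pair_word_kernel_central by (auto simp: spin_group_def)
qed

lemma spin_c_ne_one:
  assumes "4 \<le> d"
  shows "symmetric_central_extension.c (spin_group d) fst \<noteq> \<one>\<^bsub>spin_group d\<^esub>"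
proof
  interpret symmetric_central_extension "spin_group d" d fst by (rule spin_extension[OF assms])
  assume "c = \<one>\<^bsub>spin_group d\<^esub>"
  define x y where "x = pair_word [(1, 2)]" and "y = pair_word [(3, 4)]"
  have xy: "x \<in> carrier (spin_group d)" "y \<in> carrier (spin_group d)"
    using assms by (auto simp: x_def y_def spin_group_def pairs_on_def)
  have "fst x = transpose 1 2" "fst y = transpose 3 4"
    by (simp_all add: x_def y_def pair_word_Cons)
  then have "x \<otimes>\<^bsub>spin_group d\<^esub> y = c \<otimes>\<^bsub>spin_group d\<^esub> (y \<otimes>\<^bsub>spin_group d\<^esub> x)"
    using comm_swap[OF xy] by (simp only: c_def)
  then have "x \<otimes>\<^bsub>spin_group d\<^esub> y = y \<otimes>\<^bsub>spin_group d\<^esub> x"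
    using xy by (simp add: \<open>c = _\<close>)
  then have eq: "pin 1 2 \<circ> pin 3 4 = pin 3 4 \<circ> pin 1 2"
    by (simp add: spin_group_def x_def y_def pair_word_Cons)
  \<comment> \<open>The two operators anticommute; if they also commuted, their product would vanish, although it is
    invertible.\<close>
  define f where "f = pin 1 2 (pin 3 4 (\<lambda>S. 1))"
  have "f S = 0" for S
    using pin_pin[of 1 2 3 4 "\<lambda>S. 1" S] fun_cong[OF fun_cong[OF eq], of "\<lambda>S. 1" S]
    by (simp add: f_def)
  then have "f = (\<lambda>S. 0)" by auto
  moreover have "pin 3 4 (pin 1 2 f) = (\<lambda>S. 1)" by (simp add: f_def pin_square)
  moreover have "pin i j (\<lambda>S. 0) = (\<lambda>S. 0)" for i j
    using linear_opD[OF linear_op_pin, of i j 0 "\<lambda>S. 0" 0 "\<lambda>S. 0"] by simp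
  ultimately show False by (auto dest: fun_cong[of _ _ "{}"])
qed

section \<open>The group of an equipment as a central extension\<close>

locale equipped_group = group G for G (structure) +
  fixes E :: "'a set"
  assumes equip: "equipment G E"
begin

abbreviation R where "R \<equiv> equipment_relations G E"
abbreviation K where "K \<equiv> equipment_group G E"
abbreviation cls where "cls \<equiv> word_class E R"
abbreviation val where "val \<equiv> word_value G"

lemma E_conj:
  assumes "p \<in> E" "g \<in> carrier G"
  shows "g \<otimes> p \<otimes> inv g \<in> E"
proof -
  obtain X where X: "X \<subseteq> carrier G" "E = (\<Union>x\<in>X. conjugacy_class G x)"
    using equip by (auto simp: equipment_def)
  then obtain x a where x: "x \<in> X" "x \<in> carrier G" "a \<in> carrier G" "p = a \<otimes> x \<otimes> inv a"
    using assms by (auto simp: conjugacy_class_def)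
  have "g \<otimes> p \<otimes> inv g = (g \<otimes> a) \<otimes> x \<otimes> inv (g \<otimes> a)"
    using x assms(2) by (simp add: m_assoc inv_mult_group)
  then have "g \<otimes> p \<otimes> inv g \<in> conjugacy_class G x"
    using x(3) assms(2) unfolding conjugacy_class_def by blast
  then show ?thesis using x(1) X(2) by blast
qed

lemma E_sub: "E \<subseteq> carrier G"
  using equip by (auto simp: equipment_def conjugacy_class_def)

lemma words_simps [simp]:
  "[] \<in> words E" "(b, g) # w \<in> words E \<longleftrightarrow> g \<in> E \<and> w \<in> words E"
  "v @ w \<in> words E \<longleftrightarrow> v \<in> words E \<and> w \<in> words E"
  by (auto simp: words_def)

lemma val_closed [simp]: "w \<in> words E \<Longrightarrow> val w \<in> carrier G"
  using words_mono[OF E_sub] word_value_closed by blast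

text \<open>
  The second kind of relation moves a letter past a generator.  Moving it past the inverse of a
  generator uses the first kind, multiplied by the inverse from both sides.
\<close>

lemma letter_past_letter:
  assumes "h \<in> E" "g \<in> E"
  shows "pres_eq E R [(b, h), letter g] [letter (val [(b, h)] \<otimes> g \<otimes> inv (val [(b, h)])), (b, h)]"
proof (cases b)
  case True
  have "h \<in> carrier G" using assms E_sub by blast
  then have "pres_eq E R ([] @ [letter h, letter g] @ []) ([] @ [letter (h \<otimes> g \<otimes> inv h), letter h] @ [])"
    using assms E_conj by (intro pres_eq.relation) (auto simp: equipment_relations_def)
  then show ?thesis using True \<open>h \<in> carrier G\<close> by simp
next
  case False
  let ?h = "(False, h) :: bool \<times> 'a" and ?k = "inv h \<otimes> g \<otimes> h"
  have h: "h \<in> carrier G" using assms E_sub by blast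
  then have k: "?k \<in> E" using E_conj[OF assms(2), of "inv h"] by simp
  have "pres_eq E R ([?h, letter g] @ [(True, h), (\<not> True, h)] @ []) ([?h, letter g] @ [])"
    using assms by (intro pres_eq.cancel) auto
  then have "pres_eq E R [?h, letter g] ([?h] @ [letter g, letter h] @ [?h])"
    by (simp add: pres_eq.sym)
  moreover have "pres_eq E R ([?h] @ [letter g, letter h] @ [?h]) ([?h] @ [letter h, letter ?k] @ [?h])"
    using assms k by (intro pres_eq.relation) (auto simp: equipment_relations_def)
  moreover have "pres_eq E R ([] @ [(False, h), (\<not> False, h)] @ [letter ?k, ?h]) ([] @ [letter ?k, ?h])"
    using assms k by (intro pres_eq.cancel) auto
  then have "pres_eq E R ([?h] @ [letter h, letter ?k] @ [?h]) [letter ?k, ?h]" by simp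
  ultimately have "pres_eq E R [?h, letter g] [letter ?k, ?h]" by (blast intro: pres_eq.trans)
  then show ?thesis using False h by simp
qed

lemma word_past_letter:
  assumes "w \<in> words E" "g \<in> E"
  shows "pres_eq E R (w @ [letter g]) (letter (val w \<otimes> g \<otimes> inv (val w)) # w)"
  using assms(1)
proof (induction w)
  case Nil
  have "g \<in> carrier G" using assms(2) E_sub by blast
  then show ?case using assms(2) by (simp add: pres_eq.refl)
next
  case (Cons x w)
  obtain b h where x: "x = (b, h)" by (cases x)
  have h: "h \<in> E" "h \<in> carrier G" and w: "w \<in> words E" and g: "g \<in> carrier G"
    using Cons.prems assms(2) E_sub by (auto simp: x)
  let ?k = "val w \<otimes> g \<otimes> inv (val w)" and ?v = "val [(b, h)]"
  have v: "?v \<in> carrier G" "val (x # w) = ?v \<otimes> val w" using h w by (auto simp: x)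
  have k: "?k \<in> E" using E_conj[OF assms(2)] w by simp
  have "pres_eq E R ([x] @ (w @ [letter g])) ([x] @ (letter ?k # w))"
    using Cons.IH[OF w] h by (intro pres_eq_append_left) (auto simp: x)
  moreover have "pres_eq E R ([x, letter ?k] @ w) ([letter (?v \<otimes> ?k \<otimes> inv ?v), x] @ w)"
    using letter_past_letter[OF h(1) k, of b] w unfolding x by (rule pres_eq_append_right)
  moreover have "?v \<otimes> ?k \<otimes> inv ?v = val (x # w) \<otimes> g \<otimes> inv (val (x # w))"
    using v g w by (simp add: m_assoc inv_mult_group del: word_value.simps)
  ultimately show ?case by (simp del: word_value.simps) (blast intro: pres_eq.trans)
qed

text \<open>
  By \<open>word_past_letter\<close> a word over the identity does not change the letters it is moved past.
\<close>

lemma kernel_word_commutes: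
  assumes w: "w \<in> words E" "val w = \<one>" and v: "v \<in> words E"
  shows "pres_eq E R (w @ v) (v @ w)"
  using v
proof (induction v)
  case Nil
  then show ?case using w by (simp add: pres_eq.refl)
next
  case (Cons x v)
  obtain b g where x: "x = (b, g)" by (cases x)
  have g: "g \<in> E" "g \<in> carrier G" and v: "v \<in> words E" using Cons.prems E_sub by (auto simp: x)
  have pos: "pres_eq E R (w @ [letter g]) (letter g # w)"
    using word_past_letter[OF w(1) g(1)] w(2) g(2) by simp
  have "pres_eq E R (w @ [(b, g)]) ((b, g) # w)"
  proof (cases b)
    case False
    let ?n = "(False, g) :: bool \<times> 'a"
    have "pres_eq E R ([] @ [(False, g), (\<not> False, g)] @ (w @ [?n])) ([] @ (w @ [?n]))"
      using g w by (intro pres_eq.cancel) auto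
    then have "pres_eq E R (w @ [?n]) ([?n] @ (letter g # w) @ [?n])"
      by (simp add: pres_eq.sym)
    moreover have "pres_eq E R ([?n] @ ((letter g # w) @ [?n])) ([?n] @ ((w @ [letter g]) @ [?n]))"
      using pres_eq.sym[OF pos] g by (intro pres_eq_append_left pres_eq_append_right) auto
    moreover have "pres_eq E R (([?n] @ w) @ [(True, g), (\<not> True, g)] @ []) (([?n] @ w) @ [])"
      using g w by (intro pres_eq.cancel) auto
    ultimately show ?thesis using False by simp (blast intro: pres_eq.trans)
  qed (use pos in simp)
  then have "pres_eq E R ((w @ [x]) @ v) ((x # w) @ v)"
    using v unfolding x by (intro pres_eq_append_right)
  moreover have "pres_eq E R ([x] @ (w @ v)) ([x] @ (v @ w))"
    using Cons.IH[OF v] g by (intro pres_eq_append_left) (auto simp: x)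
  ultimately show ?case by simp (blast intro: pres_eq.trans)
qed

lemma K_carrier: "carrier K = cls ` words E"
  by (simp add: equipment_group_def presented_group_def)

lemma K_mult: "\<lbrakk>v \<in> words E; w \<in> words E\<rbrakk> \<Longrightarrow> cls v \<otimes>\<^bsub>K\<^esub> cls w = cls (v @ w)"
  by (simp add: equipment_group_def presented_group_mult)

lemma group_K: "group K"
  by (simp add: equipment_group_def group_presented_group)

lemma hom_cls: "w \<in> words E \<Longrightarrow> equipment_hom G (cls w) = val w"
  by (rule equipment_hom_word_class[OF E_sub])

lemma K_kernel_central:
  assumes "x \<in> carrier K" "equipment_hom G x = \<one>" "y \<in> carrier K"
  shows "x \<otimes>\<^bsub>K\<^esub> y = y \<otimes>\<^bsub>K\<^esub> x"
proof -
  obtain w v where "w \<in> words E" "x = cls w" "v \<in> words E" "y = cls v"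
    using assms by (auto simp: K_carrier)
  then show ?thesis
    using kernel_word_commutes[of w v] assms(2) by (simp add: K_mult hom_cls word_class_eq)
qed

lemma hom_surj:
  assumes "p \<in> carrier G"
  shows "\<exists>x\<in>carrier K. equipment_hom G x = p"
proof -
  have "p \<in> generate G E" using assms equip by (simp add: equipment_def)
  then have "\<exists>w\<in>words E. val w = p"
  proof induction
    case one
    show ?case by (intro bexI[of _ "[]"]) auto
  next
    case (incl h)
    then show ?case using E_sub by (intro bexI[of _ "[letter h]"]) auto
  next
    case (inv h)
    then show ?case using E_sub by (intro bexI[of _ "[(False, h)]"]) auto
  next
    case (eng g h)
    then obtain v w where "v \<in> words E" "val v = g" "w \<in> words E" "val w = h" by blast
    then show ?case
      using word_value_append words_mono[OF E_sub] by (intro bexI[of _ "v @ w"]) auto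
  qed
  then show ?thesis using hom_cls by (auto simp: K_carrier)
qed

lemma letter_commutes:
  assumes "p \<in> E" "x \<in> carrier K" "equipment_hom G x \<otimes> p = p \<otimes> equipment_hom G x"
  shows "x \<otimes>\<^bsub>K\<^esub> cls [letter p] = cls [letter p] \<otimes>\<^bsub>K\<^esub> x"
proof -
  obtain w where w: "w \<in> words E" "x = cls w" using assms(2) by (auto simp: K_carrier)
  have "val w \<otimes> p \<otimes> inv (val w) = p"
    using assms(1,3) E_sub w by (auto simp: hom_cls m_assoc)
  then have "pres_eq E R (w @ [letter p]) ([letter p] @ w)"
    using word_past_letter[OF w(1) assms(1)] by simp
  then show ?thesis using w assms(1) by (simp add: K_mult word_class_eq)
qed

text \<open>
  Replacing \<open>g\<close> by its conjugate turns a relation of the first kind into one of the second kind, so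
  the equation for \<open>f\<close> covers both.
\<close>

lemma equipment_group_universal:
  assumes H: "group H" and f: "\<And>g. g \<in> E \<Longrightarrow> f g \<in> carrier H"
    and conj: "\<And>g h. \<lbrakk>g \<in> E; h \<in> E\<rbrakk> \<Longrightarrow> f g \<otimes>\<^bsub>H\<^esub> f h = f (g \<otimes> h \<otimes> inv g) \<otimes>\<^bsub>H\<^esub> f g"
  shows "\<exists>\<phi>\<in>hom K H. \<forall>w\<in>words E. \<phi> (cls w) = word_value H (map (map_prod id f) w)"
proof -
  interpret H: group H by (rule H)
  define ev where "ev w = word_value H (map (map_prod id f) w)" for w
  have words_map: "map (map_prod id f) w \<in> words (carrier H)" if "w \<in> words E" for w
    using that f by (force simp: words_def)
  have ev_closed: "ev w \<in> carrier H" if "w \<in> words E" for w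
    using H.word_value_closed[OF words_map[OF that]] by (simp add: ev_def)
  have ev_append: "ev (v @ w) = ev v \<otimes>\<^bsub>H\<^esub> ev w" if "v \<in> words E" "w \<in> words E" for v w
    using H.word_value_append[OF words_map words_map] that by (simp add: ev_def)
  have ev_eq: "ev v = ev w" if "pres_eq E R v w" for v w
    using that
  proof induction
    case (cancel u v s b)
    have "ev [(b, s), (\<not> b, s)] = \<one>\<^bsub>H\<^esub>" using f[OF cancel(3)] by (cases b) (auto simp: ev_def)
    then show ?case using cancel by (simp add: ev_append ev_closed del: append_Cons append_Nil)
  next
    case (relation u v l r)
    have "ev l = ev r"
      using relation(3) unfolding equipment_relations_def
    proof (elim UnE CollectE exE conjE)
      fix g h assume gh: "(l, r) = ([letter g, letter h], [letter h, letter (inv h \<otimes> g \<otimes> h)])" "g \<in> E" "h \<in> E"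
      have G: "g \<in> carrier G" "h \<in> carrier G" using gh E_sub by auto
      let ?k = "inv h \<otimes> g \<otimes> h"
      have k: "?k \<in> E" using E_conj[OF gh(2), of "inv h"] G by simp
      have "f h \<otimes>\<^bsub>H\<^esub> f ?k = f (h \<otimes> ?k \<otimes> inv h) \<otimes>\<^bsub>H\<^esub> f h" by (rule conj[OF gh(3) k])
      also have "h \<otimes> ?k \<otimes> inv h = g" using G by (simp add: m_assoc)
      finally show ?thesis using gh f k by (simp add: ev_def)
    next
      fix g h assume gh: "(l, r) = ([letter g, letter h], [letter (g \<otimes> h \<otimes> inv g), letter g])" "g \<in> E" "h \<in> E"
      have k: "g \<otimes> h \<otimes> inv g \<in> E" using E_conj[OF gh(3)] gh(2) E_sub by blast
      then show ?thesis using gh f conj[OF gh(2,3)] by (simp add: ev_def)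
    qed
    then show ?case using relation by (simp add: ev_append ev_closed)
  qed auto
  define \<phi> where "\<phi> W = the_elem (ev ` W)" for W
  have \<phi>: "\<phi> (cls w) = ev w" if "w \<in> words E" for w
  proof -
    have "ev ` cls w = {ev w}"
      using ev_eq self_in_word_class[OF that] unfolding word_class_def by fastforce
    then show ?thesis by (simp add: \<phi>_def)
  qed
  have "\<phi> \<in> hom K H"
    by (rule homI) (auto simp: K_carrier \<phi> ev_closed K_mult ev_append)
  then show ?thesis using \<phi> by (intro bexI[of _ \<phi>]) (auto simp: ev_def)
qed

end

section \<open>Lifts permuted by conjugation\<close>

context symmetric_central_extension
begin

text \<open>
  Lift one representative \<open>r p\<close> of each conjugacy class and transport this lift by conjugation.  The
  result does not depend on the conjugating element, because lifts of \<open>r p\<close> commute with the lifts of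
  its centralizer.
\<close>

lemma ex_equivariant_lift:
  assumes E: "\<And>p. p \<in> E \<Longrightarrow> p permutes {1..d}"
    and conj: "\<And>p h. \<lbrakk>p \<in> E; h permutes {1..d}\<rbrakk> \<Longrightarrow> h \<circ> p \<circ> inv' h \<in> E"
    and comm: "\<And>p h. \<lbrakk>p \<in> E; h permutes {1..d}; p \<circ> h = h \<circ> p\<rbrakk> \<Longrightarrow> comm p h = \<one>"
  shows "\<exists>s. \<forall>p\<in>E. s p \<in> carrier G \<and> proj (s p) = p \<and>
    (\<forall>x\<in>carrier G. x \<otimes> s p \<otimes> inv x = s (proj x \<circ> p \<circ> inv' (proj x)))"
proof -
  define cl where "cl p = {h \<circ> p \<circ> inv' h | h. h permutes {1..d}}" for p :: "nat \<Rightarrow> nat"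
  define r where "r p = (SOME q. q \<in> cl p)" for p
  define s where "s p = (let g = SOME g. g \<in> carrier G \<and> proj g \<circ> r p \<circ> inv' (proj g) = p
    in g \<otimes> lift (r p) \<otimes> inv g)" for p
  have conj_comp: "(h \<circ> k) \<circ> p \<circ> inv' (h \<circ> k) = h \<circ> (k \<circ> p \<circ> inv' k) \<circ> inv' h"
    if "h permutes {1..d}" "k permutes {1..d}" for h k p
    using permutes_bij[OF that(1)] permutes_bij[OF that(2)]
    by (simp only: o_inv_distrib comp_assoc)
  have conj_inv: "inv' h \<circ> (h \<circ> p \<circ> inv' h) \<circ> inv' (inv' h) = p" if "h permutes {1..d}" for h p
    using conj_comp[OF permutes_inv[OF that] that, of p] by (simp add: permutes_inv_o[OF that])
  have cl_conj: "cl (h \<circ> p \<circ> inv' h) = cl p" if h: "h permutes {1..d}" for h p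
  proof -
    have sub: "cl (h \<circ> p \<circ> inv' h) \<subseteq> cl p" if h: "h permutes {1..d}" for h p
      unfolding cl_def using conj_comp[OF _ h, symmetric] permutes_compose[OF h] by blast
    have "cl p \<subseteq> cl (h \<circ> p \<circ> inv' h)"
      using sub[OF permutes_inv[OF h], of "h \<circ> p \<circ> inv' h"] by (simp only: conj_inv[OF h])
    then show ?thesis using sub[OF h] by blast
  qed
  have s: "\<exists>g\<in>carrier G. proj g \<circ> r p \<circ> inv' (proj g) = p \<and> s p = g \<otimes> lift (r p) \<otimes> inv g" for p
  proof -
    have "id \<circ> p \<circ> inv' id \<in> cl p" 
      unfolding cl_def by (rule CollectI, rule exI[of _ id]) (simp only: permutes_id simp_thms)
    then have "r p \<in> cl p" unfolding r_def by (rule someI[of "\<lambda>q. q \<in> cl p"])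
    then obtain h where h: "h permutes {1..d}" "r p = h \<circ> p \<circ> inv' h" by (auto simp: cl_def)
    have "inv' h permutes {1..d}" by (rule permutes_inv[OF h(1)])
    then have "\<exists>g. g \<in> carrier G \<and> proj g \<circ> r p \<circ> inv' (proj g) = p"
      using conj_inv[OF h(1), of p] h(2) by (intro exI[of _ "lift (inv' h)"]) simp
    from someI_ex[OF this] show ?thesis unfolding s_def Let_def by blast
  qed
  have r_E: "r p \<in> E" if "p \<in> E" for p
  proof -
    obtain g where g: "g \<in> carrier G" "proj g \<circ> r p \<circ> inv' (proj g) = p" using s by blast
    have gp: "proj g permutes {1..d}" using g proj_permutes by blast
    have "inv' (proj g) \<circ> p \<circ> inv' (inv' (proj g)) \<in> E"
      using conj[OF that permutes_inv[OF gp]] .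
    then show ?thesis using conj_inv[OF gp, of "r p"] g(2) by simp
  qed
  have lift_unique: "x \<otimes> lift q \<otimes> inv x = y \<otimes> lift q \<otimes> inv y"
    if q: "q \<in> E" and xy: "x \<in> carrier G" "y \<in> carrier G"
      "proj x \<circ> q \<circ> inv' (proj x) = proj y \<circ> q \<circ> inv' (proj y)" for x y q
  proof -
    define z where "z = inv y \<otimes> x"
    have z: "z \<in> carrier G" "x = y \<otimes> z" using xy by (simp_all add: z_def)
    have h_eq: "proj z = inv' (proj y) \<circ> proj x" using xy by (simp add: z_def)
    have "proj z \<circ> q = inv' (proj y) \<circ> (proj x \<circ> q \<circ> inv' (proj x)) \<circ> proj x"
      using inv_comp_proj[OF xy(1)] by (simp add: h_eq comp_assoc)
    also have "\<dots> = q \<circ> proj z"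
      unfolding xy(3) using inv_comp_proj[OF xy(2)] by (simp add: h_eq comp_assoc[symmetric])
    finally have "comm q (proj z) = \<one>" using comm[OF q] proj_permutes[OF z(1)] by simp
    then have "lift q \<otimes> z = z \<otimes> lift q"
      using comm_swap[of "lift q" z q "proj z"] z(1) E[OF q] by simp
    then have "z \<otimes> lift q \<otimes> inv z = lift q \<otimes> z \<otimes> inv z" by simp
    also have "\<dots> = lift q" using z(1) E[OF q] by (simp add: m_assoc)
    finally have "y \<otimes> (z \<otimes> lift q \<otimes> inv z) \<otimes> inv y = y \<otimes> lift q \<otimes> inv y" by simp
    then show ?thesis
      using z(1) xy(2) E[OF q] by (simp add: z(2) m_assoc inv_mult_group)
  qed
  show ?thesis
  proof (intro exI[of _ s] ballI conjI)
    fix p assume p: "p \<in> E"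
    obtain g where g: "g \<in> carrier G" "proj g \<circ> r p \<circ> inv' (proj g) = p"
      "s p = g \<otimes> lift (r p) \<otimes> inv g" using s by blast
    have r: "r p permutes {1..d}" using E r_E[OF p] .
    show "s p \<in> carrier G" "proj (s p) = p" using g r by simp_all
    fix x assume x: "x \<in> carrier G"
    have xp: "proj x permutes {1..d}" by (rule proj_permutes[OF x])
    let ?p = "proj x \<circ> p \<circ> inv' (proj x)"
    have r_eq: "r ?p = r p" by (simp only: r_def cl_conj[OF xp])
    obtain k where k: "k \<in> carrier G" "proj k \<circ> r p \<circ> inv' (proj k) = ?p"
      "s ?p = k \<otimes> lift (r p) \<otimes> inv k" using s[of ?p] by (auto simp: r_eq)
    have "proj (x \<otimes> g) \<circ> r p \<circ> inv' (proj (x \<otimes> g)) = ?p"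
      using conj_comp[OF xp proj_permutes[OF g(1)]] x g by simp
    then have "(x \<otimes> g) \<otimes> lift (r p) \<otimes> inv (x \<otimes> g) = k \<otimes> lift (r p) \<otimes> inv k"
      using x g k r_E[OF p] by (intro lift_unique) auto
    then show "x \<otimes> s p \<otimes> inv x = s ?p"
      using x g k r by (simp add: m_assoc inv_mult_group)
  qed
qed

lemma comm_splitting:
  assumes p: "p permutes {1..d}" and h: "h permutes {1..d}" "p \<circ> h = h \<circ> p"
    and split: "(\<not> evenperm p \<and> distinct_cycle_lengths d p) \<or> (evenperm p \<and> no_even_cycle_lengths d p)"
  shows "comm p h = \<one>"
  using split
proof
  assume "\<not> evenperm p \<and> distinct_cycle_lengths d p"
  then have "comm h p = c_if False"
    using comm_eq_one_distinct_cycles[OF _ _ _ h]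
    by (auto simp: distinct_cycle_lengths_def c_if_def)
  from comm_commute[OF h(1) p this] show ?thesis by (simp add: c_if_def)
next
  assume "evenperm p \<and> no_even_cycle_lengths d p"
  then show ?thesis
    using comm_eq_one_odd_cycles[OF _ _ h] by (auto simp: no_even_cycle_lengths_def)
qed

lemma ex_comm_nonsplitting:
  assumes p: "p permutes {1..d}"
    and split: "\<not> ((\<not> evenperm p \<and> distinct_cycle_lengths d p) \<or> (evenperm p \<and> no_even_cycle_lengths d p))"
  shows "\<exists>h. h permutes {1..d} \<and> p \<circ> h = h \<circ> p \<and> comm p h = c"
proof -
  obtain cs where cs: "disjoint_cycles d p cs" using ex_disjoint_cycles[OF p] by blast
  show ?thesis
  proof (cases "evenperm p")
    case True
    then obtain C where "C \<in> set cs" "even (length C)"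
      using split cs by (auto simp: no_even_cycle_lengths_def)
    then show ?thesis using ex_comm_eq_c_even_cycle[OF cs True] by blast
  next
    case False
    then have "\<not> distinct (map length cs)"
      using split cs unfolding distinct_cycle_lengths_def by blast
    then show ?thesis using ex_comm_eq_c_equal_cycles[OF cs False] by blast
  qed
qed

end

section \<open>The ambiguity index of the symmetric group\<close>

locale equipped_sym_group = equipped_group "sym_group d" E
  for d :: nat and E :: "(nat \<Rightarrow> nat) set" +
  assumes d: "4 \<le> d"
begin

sublocale K: symmetric_central_extension K d "equipment_hom (sym_group d)"
proof (intro symmetric_central_extension.intro symmetric_central_extension_axioms.intro group_K d)
  show "equipment_hom (sym_group d) \<in> hom K (sym_group d)"
    by (rule equipment_hom_hom[OF E_sub])
next
  fix p assume "p permutes {1..d}"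
  then show "\<exists>x\<in>carrier K. equipment_hom (sym_group d) x = p"
    by (intro hom_surj) (simp add: sym_group_carrier)
next
  fix x y assume "x \<in> carrier K" "equipment_hom (sym_group d) x = id" "y \<in> carrier K"
  then show "x \<otimes>\<^bsub>K\<^esub> y = y \<otimes>\<^bsub>K\<^esub> x" using K_kernel_central by (simp add: sym_group_one)
qed

lemma E_permutes: "p \<in> E \<Longrightarrow> p permutes {1..d}"
  using E_sub sym_group_carrier by blast

lemma ambiguity_index_eq: "ambiguity_index (sym_group d) E = card {\<one>\<^bsub>K\<^esub>, K.c}"
  unfolding ambiguity_index_def by (simp only: K.kernel_inter_derived)

text \<open>
  The letter of \<open>p\<close> is a lift of \<open>p\<close>, and conjugating it by a lift of \<open>h\<close> gives the letter of the
  conjugate of \<open>p\<close> by \<open>h\<close>, which is \<open>p\<close>.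
\<close>

lemma K_comm_E:
  assumes p: "p \<in> E" and h: "h permutes {1..d}" "p \<circ> h = h \<circ> p"
  shows "K.comm p h = \<one>\<^bsub>K\<^esub>"
proof -
  obtain x where x: "x \<in> carrier K" "equipment_hom (sym_group d) x = h"
    using K.proj_surj[OF h(1)] by blast
  have y: "cls [letter p] \<in> carrier K" "equipment_hom (sym_group d) (cls [letter p]) = p"
    using p E_sub equipment_hom_letter[OF E_sub p] by (auto simp: K_carrier)
  have "x \<otimes>\<^bsub>K\<^esub> cls [letter p] = cls [letter p] \<otimes>\<^bsub>K\<^esub> x"
    using letter_commutes[OF p x(1)] x(2) h(2) by (simp add: sym_group_mult)
  then show ?thesis
    using x y by (intro K.comm_eqI[of "cls [letter p]" x]) auto
qed

lemma c_eq_one_if_not_splitting: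
  assumes "\<not> splitting_equipment d E"
  shows "K.c = \<one>\<^bsub>K\<^esub>"
proof -
  obtain p where p: "p \<in> E"
    "\<not> ((\<not> evenperm p \<and> distinct_cycle_lengths d p) \<or> (evenperm p \<and> no_even_cycle_lengths d p))"
    using assms unfolding splitting_equipment_def by blast
  then obtain h where "h permutes {1..d}" "p \<circ> h = h \<circ> p" "K.comm p h = K.c"
    using K.ex_comm_nonsplitting[OF E_permutes] by blast
  then show ?thesis using K_comm_E[OF p(1)] by simp
qed

text \<open>
  Sending the letter of \<open>p\<close> to its equivariant lift defines a homomorphism to the spin group over the
  symmetric group.  It maps the commutator of lifts to a commutator of lifts, hence \<open>c\<close> to \<open>c\<close>.
\<close>

lemma c_ne_one_if_splitting:
  assumes split: "splitting_equipment d E"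
  shows "K.c \<noteq> \<one>\<^bsub>K\<^esub>"
proof
  assume c: "K.c = \<one>\<^bsub>K\<^esub>"
  let ?P = "spin_group d"
  interpret P: symmetric_central_extension ?P d fst by (rule spin_extension[OF d])
  have conj: "h \<circ> p \<circ> inv' h \<in> E" if "p \<in> E" "h permutes {1..d}" for p h
    using E_conj[OF that(1), of h] that(2) by (simp add: sym_group_carrier sym_group_mult)
  have comm: "P.comm p h = \<one>\<^bsub>?P\<^esub>" if "p \<in> E" "h permutes {1..d}" "p \<circ> h = h \<circ> p" for p h
    using P.comm_splitting[OF E_permutes[OF that(1)] that(2,3)] split that(1)
    unfolding splitting_equipment_def by blast
  obtain s where "\<forall>p\<in>E. s p \<in> carrier ?P \<and> fst (s p) = p \<and> (\<forall>x\<in>carrier ?P.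
      x \<otimes>\<^bsub>?P\<^esub> s p \<otimes>\<^bsub>?P\<^esub> inv\<^bsub>?P\<^esub> x = s (fst x \<circ> p \<circ> inv' (fst x)))"
    using P.ex_equivariant_lift[OF E_permutes conj comm] by blast
  then have s: "\<And>p. p \<in> E \<Longrightarrow> s p \<in> carrier ?P" "\<And>p. p \<in> E \<Longrightarrow> fst (s p) = p"
    "\<And>p x. \<lbrakk>p \<in> E; x \<in> carrier ?P\<rbrakk> \<Longrightarrow>
      x \<otimes>\<^bsub>?P\<^esub> s p \<otimes>\<^bsub>?P\<^esub> inv\<^bsub>?P\<^esub> x = s (fst x \<circ> p \<circ> inv' (fst x))"
    by blast+
  have s_conj: "s g \<otimes>\<^bsub>?P\<^esub> s h = s (g \<otimes>\<^bsub>sym_group d\<^esub> h \<otimes>\<^bsub>sym_group d\<^esub> inv\<^bsub>sym_group d\<^esub> g) \<otimes>\<^bsub>?P\<^esub> s g"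
    if "g \<in> E" "h \<in> E" for g h
  proof -
    have "s (g \<otimes>\<^bsub>sym_group d\<^esub> h \<otimes>\<^bsub>sym_group d\<^esub> inv\<^bsub>sym_group d\<^esub> g) = s g \<otimes>\<^bsub>?P\<^esub> s h \<otimes>\<^bsub>?P\<^esub> inv\<^bsub>?P\<^esub> (s g)"
      using s(3)[OF that(2) s(1)[OF that(1)]] s(2) that E_sub
      by (simp add: sym_group_mult subset_iff)
    then show ?thesis using s(1) that by (simp add: P.m_assoc)
  qed
  obtain \<phi> where \<phi>: "\<phi> \<in> hom K ?P"
    "\<And>w. w \<in> words E \<Longrightarrow> \<phi> (cls w) = word_value ?P (map (map_prod id s) w)"
    using equipment_group_universal[where f = s and H = ?P, OF P.is_group s(1) s_conj] by blast
  interpret \<phi>: group_hom K ?P \<phi>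
    using \<phi>(1) group_K P.is_group by (simp add: group_hom_def group_hom_axioms_def)
  have over: "fst (\<phi> x) = equipment_hom (sym_group d) x" if x: "x \<in> carrier K" for x
  proof -
    obtain w where w: "w \<in> words E" "x = cls w" using x by (auto simp: K_carrier)
    have "word_value ?P (map (map_prod id s) w) \<in> carrier ?P \<and>
        fst (word_value ?P (map (map_prod id s) w)) = val w"
      using w(1)
    proof (induction w)
      case Nil
      then show ?case using P.proj_one P.one_closed by (simp add: sym_group_one)
    next
      case (Cons a w)
      obtain b g where a: "a = (b, g)" by (cases a)
      have "g \<in> E" "w \<in> words E" using Cons.prems by (auto simp: a)
      then show ?case using Cons.IH s(1,2) E_sub
        by (auto simp: a sym_group_mult subset_iff)
    qed
    then show ?thesis using w \<phi>(2) hom_cls by simp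
  qed
  have t: "transpose 1 2 permutes {1..d}" "transpose 3 4 permutes {1..d}"
    using d by (auto intro!: permutes_swap_id)
  define x y where "x = K.lift (transpose 1 2)" and "y = K.lift (transpose 3 4)"
  have xy: "x \<in> carrier K" "y \<in> carrier K" using t K.lift_closed by (auto simp: x_def y_def)
  have "fst (\<phi> x) = transpose 1 2" "fst (\<phi> y) = transpose 3 4"
    using over xy t K.proj_lift by (auto simp: x_def y_def)
  then have "P.c = \<phi> x \<otimes>\<^bsub>?P\<^esub> \<phi> y \<otimes>\<^bsub>?P\<^esub> inv\<^bsub>?P\<^esub> \<phi> x \<otimes>\<^bsub>?P\<^esub> inv\<^bsub>?P\<^esub> \<phi> y"
    using P.comm_eq[of "\<phi> x" "\<phi> y"] xy by (simp only: P.c_def \<phi>.hom_closed)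
  also have "\<dots> = \<phi> (x \<otimes>\<^bsub>K\<^esub> y \<otimes>\<^bsub>K\<^esub> inv\<^bsub>K\<^esub> x \<otimes>\<^bsub>K\<^esub> inv\<^bsub>K\<^esub> y)"
    using xy by simp
  also have "\<dots> = \<phi> K.c" by (simp only: K.c_def K.comm_def x_def y_def)
  finally have "P.c = \<one>\<^bsub>?P\<^esub>" using c by simp
  then show False using spin_c_ne_one[OF d] by blast
qed

end

theorem theorem8:
  fixes d :: nat and E :: "(nat \<Rightarrow> nat) set"
  assumes "d \<ge> 4" and "equipment (sym_group d) E"
  shows "(ambiguity_index (sym_group d) E = 2 \<longleftrightarrow> splitting_equipment d E) \<and>
    (\<not> splitting_equipment d E \<longrightarrow> ambiguity_index (sym_group d) E = 1)"
proof -
  interpret equipped_sym_group d E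
    using assms sym_group_is_group
    by (simp add: equipped_sym_group_def equipped_sym_group_axioms_def equipped_group_def
        equipped_group_axioms_def)
  show ?thesis
    using c_eq_one_if_not_splitting c_ne_one_if_splitting
    by (cases "splitting_equipment d E") (auto simp: ambiguity_index_eq)
qed

end
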